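(* Let $R$ be a chain ring, $Z$ its set of zerodivisors, $N$ its nilradical and $Q=R_Z$. Assume that either $Z\neq Z^2$ or $Q$ is not coherent. Then the following conditions are equivalent: (1) $Z=N$; (2) each ideal $I$ of $R$ is flat as a module over $R/A$, where $A=(0:I)$.
   Context: All rings are commutative with unity. A chain ring (valuation ring) is a ring whose ideals are totally ordered by inclusion. For a chain ring $R$, the subset $Z$ of zerodivisors (including $0$) is a prime ideal, and $Q=R_Z$ (localization at the prime ideal $Z$) is the quotient ring of $R$. $(0:I)=\{r\in R\mid rI=0\}$ is the annihilator of $I$. *)

theory Defs
  imports "HOL-Algebra.Algebra"
begin

section \<open>Chain rings\<close>

locale chain_ring = cring +
  assumes ideals_total: "\<lbrakk>ideal I R; ideal J R\<rbrakk> \<Longrightarrow> I \<subseteq> J \<or> J \<subseteq> I"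

definition zerodivisors :: "('a, 'm) ring_scheme \<Rightarrow> 'a set" where
  "zerodivisors R = {x \<in> carrier R. x = \<zero>\<^bsub>R\<^esub> \<or>
     (\<exists>y\<in>carrier R. y \<noteq> \<zero>\<^bsub>R\<^esub> \<and> x \<otimes>\<^bsub>R\<^esub> y = \<zero>\<^bsub>R\<^esub>)}"

definition nilradical :: "('a, 'm) ring_scheme \<Rightarrow> 'a set" where
  "nilradical R = {x \<in> carrier R. \<exists>n::nat. x [^]\<^bsub>R\<^esub> n = \<zero>\<^bsub>R\<^esub>}"

definition annihilator :: "('a, 'm) ring_scheme \<Rightarrow> 'a set \<Rightarrow> 'a set" where
  "annihilator R I = {r \<in> carrier R. \<forall>x\<in>I. r \<otimes>\<^bsub>R\<^esub> x = \<zero>\<^bsub>R\<^esub>}"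


section \<open>Rings of fractions\<close>

text \<open>The fraction a/s is the class of (a, s); S need not consist of regular elements.\<close>

definition fraction :: "('a, 'm) ring_scheme \<Rightarrow> 'a set \<Rightarrow> 'a \<Rightarrow> 'a \<Rightarrow> ('a \<times> 'a) set" where
  "fraction R S a s = {(b, t). b \<in> carrier R \<and> t \<in> S \<and>
     (\<exists>u\<in>S. u \<otimes>\<^bsub>R\<^esub> (t \<otimes>\<^bsub>R\<^esub> a) = u \<otimes>\<^bsub>R\<^esub> (s \<otimes>\<^bsub>R\<^esub> b))}"

definition ring_of_fractions :: "('a, 'm) ring_scheme \<Rightarrow> 'a set \<Rightarrow> ('a \<times> 'a) set ring" where
  "ring_of_fractions R S =
    \<lparr>carrier = {fraction R S a s | a s. a \<in> carrier R \<and> s \<in> S},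
     monoid.mult = (\<lambda>U V. \<Union>{fraction R S (a \<otimes>\<^bsub>R\<^esub> b) (s \<otimes>\<^bsub>R\<^esub> t) | a s b t. (a, s) \<in> U \<and> (b, t) \<in> V}),
     monoid.one = fraction R S \<one>\<^bsub>R\<^esub> \<one>\<^bsub>R\<^esub>,
     ring.zero = fraction R S \<zero>\<^bsub>R\<^esub> \<one>\<^bsub>R\<^esub>,
     ring.add = (\<lambda>U V. \<Union>{fraction R S (t \<otimes>\<^bsub>R\<^esub> a \<oplus>\<^bsub>R\<^esub> s \<otimes>\<^bsub>R\<^esub> b) (s \<otimes>\<^bsub>R\<^esub> t) | a s b t.
        (a, s) \<in> U \<and> (b, t) \<in> V})\<rparr>"

definition localization_at :: "('a, 'm) ring_scheme \<Rightarrow> 'a set \<Rightarrow> ('a \<times> 'a) set ring" where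
  "localization_at R P = ring_of_fractions R (carrier R - P)"


lemma cring_ring_of_fractions:
  fixes R (structure)
  assumes "cring R" and S: "S \<subseteq> carrier R" "\<one>\<^bsub>R\<^esub> \<in> S"
    and mc: "\<And>s t. s \<in> S \<Longrightarrow> t \<in> S \<Longrightarrow> s \<otimes>\<^bsub>R\<^esub> t \<in> S"
  shows "cring (ring_of_fractions R S)"
proof -
  interpret cring R by fact
  have SR[simp]: "s \<in> carrier R" if "s \<in> S" for s using S that by auto
  have self: "(a, s) \<in> fraction R S a s" if "a \<in> carrier R" "s \<in> S" for a s
    using that S by (auto simp: fraction_def)
  have eqI: "fraction R S a s = fraction R S b t"
    if 0: "a \<in> carrier R" "s \<in> S" "(b,t) \<in> fraction R S a s" for a s b t
  proof -
    from 0 obtain u where u: "b \<in> carrier R" "t \<in> S" "u \<in> S" "u \<otimes> (t \<otimes> a) = u \<otimes> (s \<otimes> b)" by (auto simp: fraction_def)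
    have "(c,w) \<in> fraction R S a s \<longleftrightarrow> (c,w) \<in> fraction R S b t" if cw: "c \<in> carrier R" "w \<in> S" for c w
    proof
      assume "(c,w) \<in> fraction R S a s"
      then obtain v where v: "v \<in> S" "v \<otimes> (w \<otimes> a) = v \<otimes> (s \<otimes> c)" by (auto simp: fraction_def)
      note [simp] = 0(1) u(1) cw(1) SR[OF 0(2)] SR[OF u(2)] SR[OF u(3)] SR[OF v(1)] SR[OF cw(2)]
      have "(u \<otimes> v \<otimes> s) \<otimes> (w \<otimes> b) = (v \<otimes> w) \<otimes> (u \<otimes> (s \<otimes> b))"
        by (simp add: m_ac)
      also have "\<dots> = (v \<otimes> w) \<otimes> (u \<otimes> (t \<otimes> a))" by (simp only: u(4))
      also have "\<dots> = (u \<otimes> t) \<otimes> (v \<otimes> (w \<otimes> a))"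
        by (simp add: m_ac)
      also have "\<dots> = (u \<otimes> t) \<otimes> (v \<otimes> (s \<otimes> c))" by (simp only: v(2))
      also have "\<dots> = (u \<otimes> v \<otimes> s) \<otimes> (t \<otimes> c)"
        by (simp add: m_ac)
      finally show "(c,w) \<in> fraction R S b t"
        using cw mc[OF mc[OF u(3) v(1)] 0(2)] unfolding fraction_def by blast
    next
      assume "(c,w) \<in> fraction R S b t"
      then obtain v where v: "v \<in> S" "v \<otimes> (w \<otimes> b) = v \<otimes> (t \<otimes> c)" by (auto simp: fraction_def)
      note [simp] = 0(1) u(1) cw(1) SR[OF 0(2)] SR[OF u(2)] SR[OF u(3)] SR[OF v(1)] SR[OF cw(2)]
      have "(u \<otimes> v \<otimes> t) \<otimes> (w \<otimes> a) = (v \<otimes> w) \<otimes> (u \<otimes> (t \<otimes> a))"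
        by (simp add: m_ac)
      also have "\<dots> = (v \<otimes> w) \<otimes> (u \<otimes> (s \<otimes> b))" by (simp only: u(4))
      also have "\<dots> = (u \<otimes> s) \<otimes> (v \<otimes> (w \<otimes> b))"
        by (simp add: m_ac)
      also have "\<dots> = (u \<otimes> s) \<otimes> (v \<otimes> (t \<otimes> c))" by (simp only: v(2))
      also have "\<dots> = (u \<otimes> v \<otimes> t) \<otimes> (s \<otimes> c)"
        by (simp add: m_ac)
      finally show "(c,w) \<in> fraction R S a s"
        using cw mc[OF mc[OF u(3) v(1)] u(2)] unfolding fraction_def by blast
    qed
    then show ?thesis unfolding fraction_def by auto
  qed
  have mem: "a \<in> carrier R \<and> s \<in> S" if "(a,s) \<in> fraction R S b t" for a s b t
    using that by (auto simp: fraction_def)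
  let ?Q = "ring_of_fractions R S"
  have M: "fraction R S a s \<otimes>\<^bsub>?Q\<^esub> fraction R S b t = fraction R S (a \<otimes> b) (s \<otimes> t)"
    if "a \<in> carrier R" "s \<in> S" "b \<in> carrier R" "t \<in> S" for a s b t
  proof -
    have "fraction R S (a' \<otimes> b') (s' \<otimes> t') = fraction R S (a \<otimes> b) (s \<otimes> t)"
      if "(a',s') \<in> fraction R S a s" "(b',t') \<in> fraction R S b t" for a' b' s' t'
    proof -
      from that obtain u v where u: "u \<in> S" "u \<otimes> (s' \<otimes> a) = u \<otimes> (s \<otimes> a')" 
         and v: "v \<in> S" "v \<otimes> (t' \<otimes> b) = v \<otimes> (t \<otimes> b')"
         and c: "a' \<in> carrier R" "b' \<in> carrier R" "s' \<in> S" "t' \<in> S" by (auto simp: fraction_def)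
      note [simp] = SR[OF u(1)] SR[OF v(1)] SR[OF c(3)] SR[OF c(4)]
      note cc = c u(1) v(1) \<open>a \<in> carrier R\<close> \<open>s \<in> S\<close> \<open>b \<in> carrier R\<close> \<open>t \<in> S\<close>
      have "(u \<otimes> v) \<otimes> ((s' \<otimes> t') \<otimes> (a \<otimes> b)) = (u \<otimes> (s' \<otimes> a)) \<otimes> (v \<otimes> (t' \<otimes> b))"
        using cc by (simp add: m_ac)
      also have "\<dots> = (u \<otimes> (s \<otimes> a')) \<otimes> (v \<otimes> (t \<otimes> b'))" by (simp only: u v)
      also have "\<dots> = (u \<otimes> v) \<otimes> ((s \<otimes> t) \<otimes> (a' \<otimes> b'))"
        using cc by (simp add: m_ac)
      finally have "(a' \<otimes> b', s' \<otimes> t') \<in> fraction R S (a \<otimes> b) (s \<otimes> t)"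
        using cc mc unfolding fraction_def by auto
      then show ?thesis by (intro eqI[symmetric] m_closed mc) (use cc in simp_all)
    qed
    then have "{fraction R S (a' \<otimes> b') (s' \<otimes> t') | a' s' b' t'. (a', s') \<in> fraction R S a s \<and> (b', t') \<in> fraction R S b t}
      = {fraction R S (a \<otimes> b) (s \<otimes> t)}" using self that by blast
    then show ?thesis by (simp add: ring_of_fractions_def)
  qed
  have A: "fraction R S a s \<oplus>\<^bsub>?Q\<^esub> fraction R S b t = fraction R S (t \<otimes> a \<oplus> s \<otimes> b) (s \<otimes> t)"
    if "a \<in> carrier R" "s \<in> S" "b \<in> carrier R" "t \<in> S" for a s b t
  proof -
    have "fraction R S (t' \<otimes> a' \<oplus> s' \<otimes> b') (s' \<otimes> t') = fraction R S (t \<otimes> a \<oplus> s \<otimes> b) (s \<otimes> t)"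
      if "(a',s') \<in> fraction R S a s" "(b',t') \<in> fraction R S b t" for a' b' s' t'
    proof -
      from that obtain u v where u: "u \<in> S" "u \<otimes> (s' \<otimes> a) = u \<otimes> (s \<otimes> a')" 
         and v: "v \<in> S" "v \<otimes> (t' \<otimes> b) = v \<otimes> (t \<otimes> b')"
         and c: "a' \<in> carrier R" "b' \<in> carrier R" "s' \<in> S" "t' \<in> S" by (auto simp: fraction_def)
      note [simp] = SR[OF u(1)] SR[OF v(1)] SR[OF c(3)] SR[OF c(4)]
      note cc = c u(1) v(1) \<open>a \<in> carrier R\<close> \<open>s \<in> S\<close> \<open>b \<in> carrier R\<close> \<open>t \<in> S\<close>
      have "(u \<otimes> v) \<otimes> ((s' \<otimes> t') \<otimes> (t \<otimes> a \<oplus> s \<otimes> b)) = (u \<otimes> (s' \<otimes> a)) \<otimes> (v \<otimes> t \<otimes> t') \<oplus> (v \<otimes> (t' \<otimes> b)) \<otimes> (u \<otimes> s \<otimes> s')"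
        using cc by (simp add: m_ac r_distr)
      also have "\<dots> = (u \<otimes> (s \<otimes> a')) \<otimes> (v \<otimes> t \<otimes> t') \<oplus> (v \<otimes> (t \<otimes> b')) \<otimes> (u \<otimes> s \<otimes> s')" by (simp only: u v)
      also have "\<dots> = (u \<otimes> v) \<otimes> ((s \<otimes> t) \<otimes> (t' \<otimes> a' \<oplus> s' \<otimes> b'))"
        using cc by (simp add: m_ac r_distr)
      finally have "(t' \<otimes> a' \<oplus> s' \<otimes> b', s' \<otimes> t') \<in> fraction R S (t \<otimes> a \<oplus> s \<otimes> b) (s \<otimes> t)"
        using cc mc unfolding fraction_def by auto
      then show ?thesis by (intro eqI[symmetric] m_closed a_closed mc) (use cc in simp_all)
    qed
    then have "{fraction R S (t' \<otimes> a' \<oplus> s' \<otimes> b') (s' \<otimes> t') | a' s' b' t'. (a', s') \<in> fraction R S a s \<and> (b', t') \<in> fraction R S b t}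
      = {fraction R S (t \<otimes> a \<oplus> s \<otimes> b) (s \<otimes> t)}" using self that by blast
    then show ?thesis by (simp add: ring_of_fractions_def)
  qed
  have C: "carrier ?Q = {fraction R S a s | a s. a \<in> carrier R \<and> s \<in> S}" and
    O: "\<one>\<^bsub>?Q\<^esub> = fraction R S \<one> \<one>" and Z: "\<zero>\<^bsub>?Q\<^esub> = fraction R S \<zero> \<one>"
    by (auto simp: ring_of_fractions_def)
  have sc: "fraction R S a s = fraction R S (t \<otimes> a) (t \<otimes> s)" if "a \<in> carrier R" "s \<in> S" "t \<in> S" for a s t
    using that S mc by (intro eqI) (auto simp: fraction_def m_ac intro!: bexI[of _ \<one>])
  have E: "\<exists>a s. x = fraction R S a s \<and> a \<in> carrier R \<and> s \<in> S" if "x \<in> carrier ?Q" for x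
    using that by (auto simp: C)
  have CI: "fraction R S a s \<in> carrier ?Q" if "a \<in> carrier R" "s \<in> S" for a s
    using that by (auto simp: C)
  show ?thesis
  proof (rule cringI)
    show "abelian_group ?Q"
    proof (rule abelian_groupI)
      fix x assume "x \<in> carrier ?Q"
      then obtain a s where x: "x = fraction R S a s" "a \<in> carrier R" "s \<in> S" by (auto simp: C)
      have [simp]: "s \<in> carrier R" using x by auto
      show "\<zero>\<^bsub>?Q\<^esub> \<oplus>\<^bsub>?Q\<^esub> x = x" using x S by (simp add: A Z)
      show "\<exists>y\<in>carrier ?Q. y \<oplus>\<^bsub>?Q\<^esub> x = \<zero>\<^bsub>?Q\<^esub>"
      proof (rule bexI)
        show "fraction R S (\<ominus> a) s \<oplus>\<^bsub>?Q\<^esub> x = \<zero>\<^bsub>?Q\<^esub>"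
          using x S mc unfolding x(1) by (simp add: A Z r_minus l_neg, intro eqI) (auto simp: fraction_def intro!: bexI[of _ \<one>])
      qed (use x in \<open>auto intro: CI\<close>)
      fix y assume "y \<in> carrier ?Q"
      then obtain b t where y: "y = fraction R S b t" "b \<in> carrier R" "t \<in> S" by (auto simp: C)
      have [simp]: "t \<in> carrier R" using y by auto
      show "x \<oplus>\<^bsub>?Q\<^esub> y \<in> carrier ?Q" using x y mc by (auto simp: A intro!: CI)
      show "x \<oplus>\<^bsub>?Q\<^esub> y = y \<oplus>\<^bsub>?Q\<^esub> x" using x y mc by (simp add: A a_comm m_comm)
      fix z assume "z \<in> carrier ?Q"
      then obtain c w where z: "z = fraction R S c w" "c \<in> carrier R" "w \<in> S" by (auto simp: C)
      have [simp]: "w \<in> carrier R" using z by auto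
      have "w \<otimes> (t \<otimes> a \<oplus> s \<otimes> b) \<oplus> s \<otimes> t \<otimes> c = t \<otimes> w \<otimes> a \<oplus> s \<otimes> (w \<otimes> b \<oplus> t \<otimes> c)"
        using x(2) y(2) z(2) by (simp add: r_distr m_ac a_ac)
      then show "x \<oplus>\<^bsub>?Q\<^esub> y \<oplus>\<^bsub>?Q\<^esub> z = x \<oplus>\<^bsub>?Q\<^esub> (y \<oplus>\<^bsub>?Q\<^esub> z)"
        using x y z mc by (simp add: A m_assoc)
    qed (use S in \<open>auto simp: Z intro!: CI\<close>)
    show "comm_monoid ?Q"
    proof (rule comm_monoidI)
      fix x assume "x \<in> carrier ?Q"
      then obtain a s where x: "x = fraction R S a s" "a \<in> carrier R" "s \<in> S" by (auto simp: C)
      have [simp]: "s \<in> carrier R" using x by auto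
      show "\<one>\<^bsub>?Q\<^esub> \<otimes>\<^bsub>?Q\<^esub> x = x" using x S by (simp add: M O)
      fix y assume "y \<in> carrier ?Q"
      then obtain b t where y: "y = fraction R S b t" "b \<in> carrier R" "t \<in> S" by (auto simp: C)
      have [simp]: "t \<in> carrier R" using y by auto
      show "x \<otimes>\<^bsub>?Q\<^esub> y \<in> carrier ?Q" using x y mc by (auto simp: M intro!: CI)
      show "x \<otimes>\<^bsub>?Q\<^esub> y = y \<otimes>\<^bsub>?Q\<^esub> x" using x y mc by (simp add: M m_comm)
      fix z assume "z \<in> carrier ?Q"
      then obtain c w where z: "z = fraction R S c w" "c \<in> carrier R" "w \<in> S" by (auto simp: C)
      have [simp]: "w \<in> carrier R" using z by auto
      show "x \<otimes>\<^bsub>?Q\<^esub> y \<otimes>\<^bsub>?Q\<^esub> z = x \<otimes>\<^bsub>?Q\<^esub> (y \<otimes>\<^bsub>?Q\<^esub> z)"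
        using x y z mc by (simp add: M m_assoc)
    qed (use S in \<open>auto simp: O intro!: CI\<close>)
    fix x y z assume "x \<in> carrier ?Q" "y \<in> carrier ?Q" "z \<in> carrier ?Q"
    then obtain a s b t c w where x: "x = fraction R S a s" "a \<in> carrier R" "s \<in> S"
      "y = fraction R S b t" "b \<in> carrier R" "t \<in> S" "z = fraction R S c w" "c \<in> carrier R" "w \<in> S" by (auto simp: C)
    show "(x \<oplus>\<^bsub>?Q\<^esub> y) \<otimes>\<^bsub>?Q\<^esub> z = x \<otimes>\<^bsub>?Q\<^esub> z \<oplus>\<^bsub>?Q\<^esub> y \<otimes>\<^bsub>?Q\<^esub> z"
    proof -
      note [simp] = SR[OF x(3)] SR[OF x(6)] SR[OF x(9)] mc
      have "(t \<otimes> a \<oplus> s \<otimes> b) \<otimes> c \<in> carrier R" using x by simp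
      then have "fraction R S ((t \<otimes> a \<oplus> s \<otimes> b) \<otimes> c) (s \<otimes> t \<otimes> w) = fraction R S (w \<otimes> ((t \<otimes> a \<oplus> s \<otimes> b) \<otimes> c)) (w \<otimes> (s \<otimes> t \<otimes> w))"
        using x by (intro sc) auto
      also have "w \<otimes> ((t \<otimes> a \<oplus> s \<otimes> b) \<otimes> c) = (t \<otimes> w) \<otimes> (a \<otimes> c) \<oplus> (s \<otimes> w) \<otimes> (b \<otimes> c)"
        using x(2,5,8) by (simp add: m_ac r_distr l_distr)
      also have "w \<otimes> (s \<otimes> t \<otimes> w) = (s \<otimes> w) \<otimes> (t \<otimes> w)" by (simp add: m_ac)
      finally show ?thesis using x by (simp add: M A)
    qed
  qed
qed


section \<open>Modules\<close>

definition linear_maps ::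
  "('a, 'm) ring_scheme \<Rightarrow> ('a, 'b, 'k) module_scheme \<Rightarrow> ('a, 'c, 'l) module_scheme \<Rightarrow> ('b \<Rightarrow> 'c) set"
  where "linear_maps R M N = {f \<in> carrier M \<rightarrow> carrier N.
    (\<forall>x\<in>carrier M. \<forall>y\<in>carrier M. f (x \<oplus>\<^bsub>M\<^esub> y) = f x \<oplus>\<^bsub>N\<^esub> f y) \<and>
    (\<forall>a\<in>carrier R. \<forall>x\<in>carrier M. f (a \<odot>\<^bsub>M\<^esub> x) = a \<odot>\<^bsub>N\<^esub> f x)}"

text \<open>The record type of modules extends that of rings, so modules carry a multiplication
  and a unit; these play no role.\<close>

definition ideal_module :: "('a, 'm) ring_scheme \<Rightarrow> 'a set \<Rightarrow> ('a, 'a) module" where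
  "ideal_module R I = \<lparr>carrier = I, monoid.mult = monoid.mult R, monoid.one = \<one>\<^bsub>R\<^esub>,
     ring.zero = \<zero>\<^bsub>R\<^esub>, ring.add = ring.add R, smult = monoid.mult R\<rparr>"

text \<open>An R-module annihilated by the ideal A, viewed as a module over R/A: a coset acts through
  any of its representatives.\<close>

definition over_quotient :: "('a, 'b) module \<Rightarrow> ('a set, 'b) module" where
  "over_quotient M = \<lparr>carrier = carrier M, monoid.mult = monoid.mult M, monoid.one = \<one>\<^bsub>M\<^esub>,
     ring.zero = \<zero>\<^bsub>M\<^esub>, ring.add = ring.add M,
     smult = (\<lambda>C m. the_elem ((\<lambda>r. r \<odot>\<^bsub>M\<^esub> m) ` C))\<rparr>"

lemma module_over_quotient:
  fixes R (structure)
  assumes "cring R" "ideal I R"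
  shows "ideal (annihilator R I) R"
    "module (R Quot annihilator R I) (over_quotient (ideal_module R I))"
proof -
  interpret cring R by fact
  interpret I: ideal I R by fact
  show A: "ideal (annihilator R I) R"
  proof (rule idealI[OF ring_axioms])
    have [simp]: "x \<in> carrier R" if "x \<in> I" for x using I.a_Hcarr that by auto
    show "subgroup (annihilator R I) (add_monoid R)"
      by (rule add.subgroupI) (auto simp: annihilator_def a_inv_def[symmetric] l_distr l_minus intro!: exI[of _ \<zero>])
  qed (auto simp: annihilator_def m_assoc I.a_Hcarr I.I_l_closed)
  interpret A: ideal "annihilator R I" R by (rule A)
  have sm: "(annihilator R I +> r) \<odot>\<^bsub>over_quotient (ideal_module R I)\<^esub> x = r \<otimes> x" if "r \<in> carrier R" "x \<in> I" for r x
  proof -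
    have "(\<lambda>r. r \<otimes> x) ` (annihilator R I +> r) = {r \<otimes> x}"
    proof -
      have "y \<otimes> x = r \<otimes> x" if y: "y \<in> annihilator R I +> r" for y
      proof -
        from y obtain h where "h \<in> annihilator R I" "y = h \<oplus> r" by (auto simp: a_r_coset_def')
        moreover have "h \<in> carrier R" "h \<otimes> x = \<zero>" using \<open>h \<in> annihilator R I\<close> \<open>x \<in> I\<close> unfolding annihilator_def by auto
        ultimately show ?thesis using \<open>r \<in> carrier R\<close> I.a_Hcarr[OF \<open>x \<in> I\<close>] by (simp only: l_distr l_zero m_closed)
      qed
      then show ?thesis using A.a_rcos_self[OF that(1)] by blast
    qed
    then show ?thesis by (simp add: over_quotient_def ideal_module_def)
  qed
  have c: "carrier (over_quotient (ideal_module R I)) = I" "add (over_quotient (ideal_module R I)) = add R" "ring.zero (over_quotient (ideal_module R I)) = \<zero>"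
    by (auto simp: over_quotient_def ideal_module_def)
  show "module (R Quot annihilator R I) (over_quotient (ideal_module R I))"
  proof (rule moduleI)
    show "cring (R Quot annihilator R I)" by (rule A.quotient_is_cring) fact
    show "abelian_group (over_quotient (ideal_module R I))"
    proof (rule abelian_groupI)
      fix x assume "x \<in> carrier (over_quotient (ideal_module R I))"
      then have "\<ominus> x \<in> I" "\<ominus> x \<oplus> x = \<zero>" by (auto simp: c I.a_Hcarr l_neg)
      then show "\<exists>y\<in>carrier (over_quotient (ideal_module R I)). y \<oplus>\<^bsub>over_quotient (ideal_module R I)\<^esub> x = \<zero>\<^bsub>over_quotient (ideal_module R I)\<^esub>"
        by (auto simp: c)
    qed (simp_all add: c I.a_Hcarr a_ac)
  qed (auto simp: c FactRing_simps sm A.rcoset_mult_add A.a_rcos_sum I.a_Hcarr l_distr r_distr m_assoc I.I_l_closed)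
qed

definition free_module :: "('a, 'm) ring_scheme \<Rightarrow> nat \<Rightarrow> ('a, nat \<Rightarrow> 'a) module" where
  "free_module R n = \<lparr>carrier = {..<n} \<rightarrow>\<^sub>E carrier R,
     monoid.mult = (\<lambda>v w. \<lambda>i\<in>{..<n}. v i \<otimes>\<^bsub>R\<^esub> w i), monoid.one = (\<lambda>i\<in>{..<n}. \<one>\<^bsub>R\<^esub>),
     ring.zero = (\<lambda>i\<in>{..<n}. \<zero>\<^bsub>R\<^esub>), ring.add = (\<lambda>v w. \<lambda>i\<in>{..<n}. v i \<oplus>\<^bsub>R\<^esub> w i),
     smult = (\<lambda>a v. \<lambda>i\<in>{..<n}. a \<otimes>\<^bsub>R\<^esub> v i)\<rparr>"


section \<open>Coherent rings\<close>

definition finitely_generated_ideal :: "('a, 'm) ring_scheme \<Rightarrow> 'a set \<Rightarrow> bool" where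
  "finitely_generated_ideal R I \<longleftrightarrow> (\<exists>G. finite G \<and> G \<subseteq> carrier R \<and> I = genideal R G)"

text \<open>There is an exact sequence from \<open>R\<^sup>m\<close> via \<open>R\<^sup>n\<close> and M to 0.\<close>

definition finitely_presented :: "('a, 'm) ring_scheme \<Rightarrow> ('a, 'b, 'k) module_scheme \<Rightarrow> bool" where
  "finitely_presented R M \<longleftrightarrow> module R M \<and>
     (\<exists>m n. \<exists>g \<in> linear_maps R (free_module R m) (free_module R n).
            \<exists>f \<in> linear_maps R (free_module R n) M.
        f ` carrier (free_module R n) = carrier M \<and>
        g ` carrier (free_module R m) = {v \<in> carrier (free_module R n). f v = \<zero>\<^bsub>M\<^esub>})"

definition coherent_ring :: "('a, 'm) ring_scheme \<Rightarrow> bool" where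
  "coherent_ring R \<longleftrightarrow> cring R \<and>
     (\<forall>I. finitely_generated_ideal R I \<longrightarrow> finitely_presented R (ideal_module R I))"


section \<open>Tensor products and flat modules\<close>

text \<open>The tensor product as an abelian group: pairs generate a free abelian group, which is
  divided by the subgroup generated by the relators of biadditivity and balancedness.\<close>

definition tensor_relators ::
  "('a, 'm) ring_scheme \<Rightarrow> ('a, 'b, 'k) module_scheme \<Rightarrow> ('a, 'c, 'l) module_scheme \<Rightarrow> ('b \<times> 'c \<Rightarrow>\<^sub>0 int) set"
  where "tensor_relators R M N =
    {frag_of (x \<oplus>\<^bsub>M\<^esub> x', y) - frag_of (x, y) - frag_of (x', y) | x x' y.
       x \<in> carrier M \<and> x' \<in> carrier M \<and> y \<in> carrier N} \<union>
    {frag_of (x, y \<oplus>\<^bsub>N\<^esub> y') - frag_of (x, y) - frag_of (x, y') | x y y'.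
       x \<in> carrier M \<and> y \<in> carrier N \<and> y' \<in> carrier N} \<union>
    {frag_of (a \<odot>\<^bsub>M\<^esub> x, y) - frag_of (x, a \<odot>\<^bsub>N\<^esub> y) | a x y.
       a \<in> carrier R \<and> x \<in> carrier M \<and> y \<in> carrier N}"

definition tensor_kernel ::
  "('a, 'm) ring_scheme \<Rightarrow> ('a, 'b, 'k) module_scheme \<Rightarrow> ('a, 'c, 'l) module_scheme \<Rightarrow> ('b \<times> 'c \<Rightarrow>\<^sub>0 int) set"
  where "tensor_kernel R M N =
    generate (free_Abelian_group (carrier M \<times> carrier N)) (tensor_relators R M N)"

definition tensor_product ::
  "('a, 'm) ring_scheme \<Rightarrow> ('a, 'b, 'k) module_scheme \<Rightarrow> ('a, 'c, 'l) module_scheme \<Rightarrow> ('b \<times> 'c \<Rightarrow>\<^sub>0 int) set monoid"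
  where "tensor_product R M N =
    free_Abelian_group (carrier M \<times> carrier N) Mod tensor_kernel R M N"

definition map_first :: "('c \<Rightarrow> 'b) \<Rightarrow> ('c \<times> 'p \<Rightarrow>\<^sub>0 int) \<Rightarrow> ('b \<times> 'p \<Rightarrow>\<^sub>0 int)" where
  "map_first f = frag_extend (\<lambda>(n, p). frag_of (f n, p))"

text \<open>The map from \<open>M \<otimes> P\<close> to \<open>N \<otimes> P\<close> induced by f from M to N. The members of the union
  all coincide when f is linear.\<close>

definition tensor_map ::
  "('a, 'm) ring_scheme \<Rightarrow> ('a, 'b, 'k) module_scheme \<Rightarrow> ('a, 'p, 'l) module_scheme \<Rightarrow> ('c \<Rightarrow> 'b) \<Rightarrow>
    ('c \<times> 'p \<Rightarrow>\<^sub>0 int) set \<Rightarrow> ('b \<times> 'p \<Rightarrow>\<^sub>0 int) set"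
  where "tensor_map R N P f C =
    (\<Union>x\<in>C. tensor_kernel R N P #>\<^bsub>free_Abelian_group (carrier N \<times> carrier P)\<^esub>
               map_first f x)"

text \<open>A definition cannot quantify over all carrier types of test modules. The type chosen here
  has room for a copy of every countably generated module over R, which makes the definition
  independent of the choice: see \<open>flat_moduleD\<close> below.\<close>

definition flat_module :: "('a, 'm) ring_scheme \<Rightarrow> ('a, 'p, 'k) module_scheme \<Rightarrow> bool" where
  "flat_module R P \<longleftrightarrow> module R P \<and>
     (\<forall>(M :: ('a, (nat \<Rightarrow> 'a) set) module) (N :: ('a, (nat \<Rightarrow> 'a) set) module).
        \<forall>f \<in> linear_maps R M N. module R M \<and> module R N \<and> inj_on f (carrier M) \<longrightarrow>
          inj_on (tensor_map R N P f) (carrier (tensor_product R M P)))"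


subsection \<open>Flatness controls test modules of every type\<close>

lemma keys_tensor_relators:
  assumes "module R M" "module R N" "r \<in> tensor_relators R M N"
  shows "Poly_Mapping.keys r \<subseteq> carrier M \<times> carrier N"
proof -
  interpret M: module R M by fact
  interpret N: module R N by fact
  show ?thesis
    using assms(3) unfolding tensor_relators_def
    by (auto dest!: subsetD[OF keys_diff] simp: keys_frag_of)
qed

lemma tensor_kernel_subgroup:
  assumes "module R M" "module R N"
  shows "subgroup (tensor_kernel R M N) (free_Abelian_group (carrier M \<times> carrier N))"
  unfolding tensor_kernel_def
  by (rule group.generate_is_subgroup) (use keys_tensor_relators[OF assms] in auto)

lemma tensor_kernel_add:
  "x \<in> tensor_kernel R M N \<Longrightarrow> y \<in> tensor_kernel R M N \<Longrightarrow> x + y \<in> tensor_kernel R M N"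
  unfolding tensor_kernel_def
  using generate.eng[of _ "free_Abelian_group (carrier M \<times> carrier N)"] by simp

lemma tensor_kernel_zero: "0 \<in> tensor_kernel R M N"
  unfolding tensor_kernel_def
  using generate.one[of "free_Abelian_group (carrier M \<times> carrier N)"] by simp

lemma tensor_kernel_keys:
  assumes "module R M" "module R N" "x \<in> tensor_kernel R M N"
  shows "Poly_Mapping.keys x \<subseteq> carrier M \<times> carrier N"
  using subgroup.subset[OF tensor_kernel_subgroup[OF assms(1,2)]] assms(3)
  by (auto dest: subsetD simp del: carrier_free_Abelian_group_iff simp flip: carrier_free_Abelian_group_iff)

lemma tensor_kernel_minus:
  assumes "module R M" "module R N" "x \<in> tensor_kernel R M N"
  shows "- x \<in> tensor_kernel R M N"
  using subgroup.m_inv_closed[OF tensor_kernel_subgroup[OF assms(1,2)] assms(3)]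
    tensor_kernel_keys[OF assms] by simp

lemma tensor_kernel_relator: "r \<in> tensor_relators R M N \<Longrightarrow> r \<in> tensor_kernel R M N"
  unfolding tensor_kernel_def by (rule generate.incl)

lemma tensor_kernel_induct [consumes 3, case_names zero relator minus add]:
  assumes "module R M" "module R N" and x: "x \<in> tensor_kernel R M N"
    and "P 0" "\<And>r. r \<in> tensor_relators R M N \<Longrightarrow> P r"
    and m: "\<And>x. P x \<Longrightarrow> P (- x)" and a: "\<And>x y. P x \<Longrightarrow> P y \<Longrightarrow> P (x + y)"
  shows "P x"
  using x unfolding tensor_kernel_def
proof (induction rule: generate.induct)
  case (inv h)
  then show ?case using keys_tensor_relators[OF assms(1,2) inv] assms(5)[OF inv] m by simp
qed (use assms in auto)

lemma map_first_relator:
  assumes "f \<in> linear_maps R M N" "r \<in> tensor_relators R M P" "module R M"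
  shows "map_first f r \<in> tensor_relators R N P"
proof -
  interpret module R M by fact
  have f: "f x \<in> carrier N" if "x \<in> carrier M" for x using assms that by (auto simp: linear_maps_def)
  have fa: "f (x \<oplus>\<^bsub>M\<^esub> y) = f x \<oplus>\<^bsub>N\<^esub> f y" if "x \<in> carrier M" "y \<in> carrier M" for x y
    using assms that by (auto simp: linear_maps_def)
  have fs: "f (a \<odot>\<^bsub>M\<^esub> x) = a \<odot>\<^bsub>N\<^esub> f x" if "x \<in> carrier M" "a \<in> carrier R" for a x
    using assms that by (auto simp: linear_maps_def)
  from assms(2) consider 
     (1) x x' y where "r = frag_of (x \<oplus>\<^bsub>M\<^esub> x', y) - frag_of (x, y) - frag_of (x', y)" "x \<in> carrier M" "x' \<in> carrier M" "y \<in> carrier P"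
   | (2) x y y' where "r = frag_of (x, y \<oplus>\<^bsub>P\<^esub> y') - frag_of (x, y) - frag_of (x, y')" "x \<in> carrier M" "y \<in> carrier P" "y' \<in> carrier P"
   | (3) a x y where "r = frag_of (a \<odot>\<^bsub>M\<^esub> x, y) - frag_of (x, a \<odot>\<^bsub>P\<^esub> y)" "a \<in> carrier R" "x \<in> carrier M" "y \<in> carrier P"
    unfolding tensor_relators_def by blast
  then show ?thesis
  proof cases
    case 1
    then have "map_first f r = frag_of (f x \<oplus>\<^bsub>N\<^esub> f x', y) - frag_of (f x, y) - frag_of (f x', y)"
      by (simp add: map_first_def frag_extend_diff fa)
    then show ?thesis unfolding tensor_relators_def using 1 f by blast
  next
    case 2
    then have "map_first f r = frag_of (f x, y \<oplus>\<^bsub>P\<^esub> y') - frag_of (f x, y) - frag_of (f x, y')"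
      by (simp add: map_first_def frag_extend_diff)
    then show ?thesis unfolding tensor_relators_def using 2 f by blast
  next
    case 3
    then have "map_first f r = frag_of (a \<odot>\<^bsub>N\<^esub> f x, y) - frag_of (f x, a \<odot>\<^bsub>P\<^esub> y)"
      by (simp add: map_first_def frag_extend_diff fs)
    then show ?thesis unfolding tensor_relators_def using 3 f by blast
  qed
qed

lemma map_first_kernel:
  assumes "f \<in> linear_maps R M N" "module R M" "module R N" "module R P" "x \<in> tensor_kernel R M P"
  shows "map_first f x \<in> tensor_kernel R N P"
  using assms(2,4,5)
proof (induction rule: tensor_kernel_induct)
  case (relator r)
  then show ?case using map_first_relator[OF assms(1) relator assms(2)] tensor_kernel_relator by blast
qed (auto simp: map_first_def frag_extend_minus frag_extend_add tensor_kernel_zero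
      intro!: tensor_kernel_add tensor_kernel_minus assms)

lemma keys_fmap:
  assumes "Poly_Mapping.keys x \<subseteq> A \<times> B" "f ` A \<subseteq> C"
  shows "Poly_Mapping.keys (map_first f x) \<subseteq> C \<times> B"
  unfolding map_first_def using assms by (intro order_trans[OF keys_frag_extend]) (force simp: keys_frag_of)

lemma map_first_fmap: "map_first g (map_first f x) = map_first (g \<circ> f) x"
proof -
  have "Poly_Mapping.keys x \<subseteq> UNIV" by simp
  then show ?thesis
    by (induction x rule: frag_induction) (auto simp: map_first_def frag_extend_diff)
qed

lemma map_first_cong: "(\<And>n p. (n, p) \<in> Poly_Mapping.keys x \<Longrightarrow> f n = g n) \<Longrightarrow> map_first f x = map_first g x"
  unfolding map_first_def by (rule frag_extend_eq) auto

lemma map_first_id: "map_first id x = x"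
proof -
  have "Poly_Mapping.keys x \<subseteq> UNIV" by simp
  then show ?thesis
    by (induction x rule: frag_induction) (auto simp: map_first_def frag_extend_diff)
qed

lemma free_coset_eq_iff:
  fixes K :: "('z \<Rightarrow>\<^sub>0 int) set"
  assumes K: "subgroup K (free_Abelian_group S)" and that: "Poly_Mapping.keys x \<subseteq> S" "Poly_Mapping.keys y \<subseteq> S"
  shows "K #>\<^bsub>free_Abelian_group S\<^esub> x = K #>\<^bsub>free_Abelian_group S\<^esub> y \<longleftrightarrow> x - y \<in> K"
  proof
    assume "K #>\<^bsub>free_Abelian_group S\<^esub> x = K #>\<^bsub>free_Abelian_group S\<^esub> y"
    moreover have "x \<in> K #>\<^bsub>free_Abelian_group S\<^esub> x"
      using K that by (intro group.rcos_self) auto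
    ultimately obtain k where "k \<in> K" "x = k + y" by (auto simp: r_coset_def)
    then show "x - y \<in> K" by simp
  next
    assume a: "x - y \<in> K"
    have "x \<in> K #>\<^bsub>free_Abelian_group S\<^esub> y" using a by (auto simp: r_coset_def intro!: bexI[of _ "x - y"])
    then show "K #>\<^bsub>free_Abelian_group S\<^esub> x = K #>\<^bsub>free_Abelian_group S\<^esub> y"
      by (rule sym[OF group.repr_independence[OF group_free_Abelian_group]]) (use that K in simp_all)
  qed

lemma inj_tensor_map_iff:
  assumes "f \<in> linear_maps R M N" "module R M" "module R N" "module R P"
  shows "inj_on (tensor_map R N P f) (carrier (tensor_product R M P)) \<longleftrightarrow>
    (\<forall>x. Poly_Mapping.keys x \<subseteq> carrier M \<times> carrier P \<longrightarrow> map_first f x \<in> tensor_kernel R N P \<longrightarrow> x \<in> tensor_kernel R M P)"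
    (is "?L \<longleftrightarrow> ?R")
proof -
  let ?F = "free_Abelian_group (carrier M \<times> carrier P)" and ?G = "free_Abelian_group (carrier N \<times> carrier P)"
  let ?K = "tensor_kernel R M P" and ?L' = "tensor_kernel R N P"
  have KF: "subgroup ?K ?F" and KG: "subgroup ?L' ?G" using assms tensor_kernel_subgroup by auto
  have fC: "f ` carrier M \<subseteq> carrier N" using assms(1) by (auto simp: linear_maps_def)
  have tm: "tensor_map R N P f (?K #>\<^bsub>?F\<^esub> x) = ?L' #>\<^bsub>?G\<^esub> map_first f x"
    if x: "Poly_Mapping.keys x \<subseteq> carrier M \<times> carrier P" for x
  proof -
    have "?L' #>\<^bsub>?G\<^esub> map_first f y = ?L' #>\<^bsub>?G\<^esub> map_first f x" if y: "y \<in> ?K #>\<^bsub>?F\<^esub> x" for y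
    proof -
      from y obtain k where k: "k \<in> ?K" "y = k + x" by (auto simp: r_coset_def)
      have "Poly_Mapping.keys y \<subseteq> carrier M \<times> carrier P"
        using k x tensor_kernel_keys[OF assms(2,4) k(1)] keys_add[of k x] by auto
      moreover have "map_first f y - map_first f x = map_first f k" by (simp add: k(2) map_first_def frag_extend_add)
      ultimately show ?thesis
        using free_coset_eq_iff[OF KG keys_fmap[OF _ fC] keys_fmap[OF _ fC]] x map_first_kernel[OF assms k(1)] by simp
    qed
    moreover have "x \<in> ?K #>\<^bsub>?F\<^esub> x" using KF x by (intro group.rcos_self) auto
    ultimately show ?thesis unfolding tensor_map_def by blast
  qed
  have C: "carrier (tensor_product R M P) = {?K #>\<^bsub>?F\<^esub> x | x. Poly_Mapping.keys x \<subseteq> carrier M \<times> carrier P}"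
    unfolding tensor_product_def FactGroup_def RCOSETS_def by auto
  show ?thesis
  proof
    assume L: ?L
    show ?R
    proof (intro allI impI)
      fix x assume x: "Poly_Mapping.keys x \<subseteq> carrier M \<times> carrier P" "map_first f x \<in> ?L'"
      have "tensor_map R N P f (?K #>\<^bsub>?F\<^esub> x) = tensor_map R N P f (?K #>\<^bsub>?F\<^esub> 0)"
        using x free_coset_eq_iff[OF KG keys_fmap[OF _ fC], of x 0] by (simp add: tm) (simp add: map_first_def)
      then have "?K #>\<^bsub>?F\<^esub> x = ?K #>\<^bsub>?F\<^esub> 0"
      proof (rule inj_onD[OF L])
        show "?K #>\<^bsub>?F\<^esub> x \<in> carrier (tensor_product R M P)" unfolding C using x by blast
        show "?K #>\<^bsub>?F\<^esub> 0 \<in> carrier (tensor_product R M P)" unfolding C by (rule CollectI, rule exI[of _ 0]) simp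
      qed
      then show "x \<in> ?K" using free_coset_eq_iff[OF KF, of x 0] x by simp
    qed
  next
    assume r: ?R
    show ?L
    proof (rule inj_onI)
      fix A B assume "A \<in> carrier (tensor_product R M P)" "B \<in> carrier (tensor_product R M P)"
         and eq: "tensor_map R N P f A = tensor_map R N P f B"
      then obtain x y where A: "A = ?K #>\<^bsub>?F\<^esub> x" "Poly_Mapping.keys x \<subseteq> carrier M \<times> carrier P"
         and B: "B = ?K #>\<^bsub>?F\<^esub> y" "Poly_Mapping.keys y \<subseteq> carrier M \<times> carrier P" by (auto simp: C)
      have "map_first f (x - y) \<in> ?L'"
        using eq A B free_coset_eq_iff[OF KG keys_fmap[OF _ fC] keys_fmap[OF _ fC], of x y]
        by (simp add: tm map_first_def frag_extend_diff)
      then have "x - y \<in> ?K" using r A B keys_diff[of x y] by blast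
      then show "A = B" using free_coset_eq_iff[OF KF] A B by simp
    qed
  qed
qed

text \<open>Transport of a module along an injection of its carrier.\<close>

definition transport :: "('b \<Rightarrow> 'c) \<Rightarrow> ('a, 'b, 'k) module_scheme \<Rightarrow> ('a, 'c) module" where
  "transport e M = 
    \<lparr>carrier = e ` carrier M, monoid.mult = (\<lambda>x y. e (inv_into (carrier M) e x \<otimes>\<^bsub>M\<^esub> inv_into (carrier M) e y)), monoid.one = e \<one>\<^bsub>M\<^esub>, ring.zero = e \<zero>\<^bsub>M\<^esub>,
     ring.add = (\<lambda>x y. e (inv_into (carrier M) e x \<oplus>\<^bsub>M\<^esub> inv_into (carrier M) e y)), smult = (\<lambda>a x. e (a \<odot>\<^bsub>M\<^esub> inv_into (carrier M) e x))\<rparr>"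

lemma transport:
  assumes "module R M" and e: "inj_on e (carrier M)"
  shows "module R (transport e M)" "e \<in> linear_maps R M (transport e M)"
    "inv_into (carrier M) e \<in> linear_maps R (transport e M) M"
    "carrier (transport e M) = e ` carrier M"
proof -
  interpret module R M by fact
  let ?T = "transport e M"
  have [simp]: "inv_into (carrier M) e (e x) = x" if "x \<in> carrier M" for x using that e by simp
  show c: "carrier ?T = e ` carrier M" by (simp add: transport_def)
  have a: "e x \<oplus>\<^bsub>?T\<^esub> e y = e (x \<oplus>\<^bsub>M\<^esub> y)" if "x \<in> carrier M" "y \<in> carrier M" for x y
    using that by (simp add: transport_def)
  have s: "a \<odot>\<^bsub>?T\<^esub> e x = e (a \<odot>\<^bsub>M\<^esub> x)" if "x \<in> carrier M" for a x
    using that by (simp add: transport_def)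
  have z: "\<zero>\<^bsub>?T\<^esub> = e \<zero>\<^bsub>M\<^esub>" by (simp add: transport_def)
  show "e \<in> linear_maps R M ?T" by (auto simp: linear_maps_def c a s)
  show "inv_into (carrier M) e \<in> linear_maps R ?T M" by (auto simp: linear_maps_def c a s)
  show "module R ?T"
  proof (rule moduleI)
    show "cring R" ..
    show "abelian_group ?T"
    proof (rule abelian_groupI)
      fix x assume "x \<in> carrier ?T"
      then obtain u where u: "x = e u" "u \<in> carrier M" by (auto simp: c)
      have "e (\<ominus>\<^bsub>M\<^esub> u) \<oplus>\<^bsub>?T\<^esub> x = \<zero>\<^bsub>?T\<^esub>" using u by (simp add: a z M.l_neg)
      then show "\<exists>y\<in>carrier ?T. y \<oplus>\<^bsub>?T\<^esub> x = \<zero>\<^bsub>?T\<^esub>" using u by (auto simp: c)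
    qed (auto simp: c a z M.a_ac)
  qed (auto simp: c a s smult_l_distr smult_r_distr smult_assoc1)
qed

lemma tensor_kernel_finite_support:
  assumes N: "module R N" and P: "module R P" and x: "x \<in> tensor_kernel R N P"
  shows "\<exists>G. finite G \<and> G \<subseteq> carrier N \<and>
    (\<forall>H. submodule H R N \<longrightarrow> G \<subseteq> H \<longrightarrow> x \<in> tensor_kernel R (N\<lparr>carrier := H\<rparr>) P)"
  using N P x
proof (induction rule: tensor_kernel_induct)
  case zero
  then show ?case by (auto intro!: exI[of _ "{}"] tensor_kernel_zero)
next
  case (relator r)
  interpret N: module R N by fact
  from relator consider 
     (1) x x' y where "r = frag_of (x \<oplus>\<^bsub>N\<^esub> x', y) - frag_of (x, y) - frag_of (x', y)" "x \<in> carrier N" "x' \<in> carrier N" "y \<in> carrier P"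
   | (2) x y y' where "r = frag_of (x, y \<oplus>\<^bsub>P\<^esub> y') - frag_of (x, y) - frag_of (x, y')" "x \<in> carrier N" "y \<in> carrier P" "y' \<in> carrier P"
   | (3) a x y where "r = frag_of (a \<odot>\<^bsub>N\<^esub> x, y) - frag_of (x, a \<odot>\<^bsub>P\<^esub> y)" "a \<in> carrier R" "x \<in> carrier N" "y \<in> carrier P"
    unfolding tensor_relators_def by blast
  then show ?case
  proof cases
    case 1
    have "r \<in> tensor_relators R (N\<lparr>carrier := H\<rparr>) P" if "{x,x'} \<subseteq> H" for H
      using 1 that unfolding tensor_relators_def by auto
    then show ?thesis using 1 by (intro exI[of _ "{x,x'}"]) (auto intro: tensor_kernel_relator)
  next
    case 2
    have "r \<in> tensor_relators R (N\<lparr>carrier := H\<rparr>) P" if "{x} \<subseteq> H" for H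
      using 2 that unfolding tensor_relators_def by auto
    then show ?thesis using 2 by (intro exI[of _ "{x}"]) (auto intro: tensor_kernel_relator)
  next
    case 3
    have "r \<in> tensor_relators R (N\<lparr>carrier := H\<rparr>) P" if "{x} \<subseteq> H" for H
      using 3 that unfolding tensor_relators_def by auto
    then show ?thesis using 3 by (intro exI[of _ "{x}"]) (auto intro: tensor_kernel_relator)
  qed
next
  case (minus x)
  then obtain G where G: "finite G" "G \<subseteq> carrier N"
    "\<And>H. submodule H R N \<Longrightarrow> G \<subseteq> H \<Longrightarrow> x \<in> tensor_kernel R (N\<lparr>carrier := H\<rparr>) P" by blast
  then show ?case
    by (intro exI[of _ G]) (auto intro!: tensor_kernel_minus submodule.submodule_is_module N P)
next
  case (add x y)
  then obtain G G' where G: "finite G" "G \<subseteq> carrier N"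
    "\<And>H. submodule H R N \<Longrightarrow> G \<subseteq> H \<Longrightarrow> x \<in> tensor_kernel R (N\<lparr>carrier := H\<rparr>) P"
    "finite G'" "G' \<subseteq> carrier N"
    "\<And>H. submodule H R N \<Longrightarrow> G' \<subseteq> H \<Longrightarrow> y \<in> tensor_kernel R (N\<lparr>carrier := H\<rparr>) P" by blast
  then show ?case
    by (intro exI[of _ "G \<union> G'"]) (auto intro!: tensor_kernel_add)
qed

lemma finite_subset_in_small_submodule:
  assumes N: "module R (N :: ('a, 'b, 'k) module_scheme)" and G: "finite G" "G \<subseteq> carrier N"
  shows "\<exists>H (e :: 'b \<Rightarrow> (nat \<Rightarrow> 'a) set). submodule H R N \<and> G \<subseteq> H \<and> inj_on e H"
proof -
  interpret module R N by fact
  obtain g and k :: nat where g: "G = g ` {..<k}"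
    using finite_imp_nat_seg_image_inj_on[OF G(1)] by (metis lessThan_def)
  have gc[simp]: "g i \<in> carrier N" if "i < k" for i using G that by (auto simp: g)
  define L where "L c = (\<Oplus>\<^bsub>N\<^esub> i\<in>{..<k}. c i \<odot>\<^bsub>N\<^esub> g i)" for c
  let ?C = "UNIV \<rightarrow> carrier R"
  define H where "H = L ` ?C"
  define e where "e h = {c \<in> ?C. L c = h}" for h
  have inj: "inj_on e H"
    by (rule inj_onI) (auto simp: e_def H_def set_eq_iff)
  have Lc: "L c \<in> carrier N" if "c \<in> ?C" for c
    using that unfolding L_def by (intro M.finsum_closed) (auto simp: Pi_def)
  have La: "L c \<oplus>\<^bsub>N\<^esub> L d = L (\<lambda>i. c i \<oplus>\<^bsub>R\<^esub> d i)" if "c \<in> ?C" "d \<in> ?C" for c d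
  proof -
    have "L (\<lambda>i. c i \<oplus>\<^bsub>R\<^esub> d i) = (\<Oplus>\<^bsub>N\<^esub> i\<in>{..<k}. c i \<odot>\<^bsub>N\<^esub> g i \<oplus>\<^bsub>N\<^esub> d i \<odot>\<^bsub>N\<^esub> g i)"
      unfolding L_def using that by (intro M.finsum_cong') (auto simp: Pi_def smult_l_distr)
    also have "\<dots> = L c \<oplus>\<^bsub>N\<^esub> L d"
      unfolding L_def using that by (intro M.finsum_addf) (auto simp: Pi_def)
    finally show ?thesis by simp
  qed
  have Ls: "a \<odot>\<^bsub>N\<^esub> L c = L (\<lambda>i. a \<otimes>\<^bsub>R\<^esub> c i)" if "c \<in> ?C" "a \<in> carrier R" for c a
  proof -
    have "a \<odot>\<^bsub>N\<^esub> L c = (\<Oplus>\<^bsub>N\<^esub> i\<in>{..<k}. a \<odot>\<^bsub>N\<^esub> (c i \<odot>\<^bsub>N\<^esub> g i))"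
      unfolding L_def using that by (intro finsum_smult_ldistr) (auto simp: Pi_def)
    also have "\<dots> = L (\<lambda>i. a \<otimes>\<^bsub>R\<^esub> c i)"
      unfolding L_def using that by (intro M.finsum_cong') (auto simp: Pi_def smult_assoc1)
    finally show ?thesis .
  qed
  have Hs: "a \<odot>\<^bsub>N\<^esub> h \<in> H" if "a \<in> carrier R" "h \<in> H" for a h
    using that by (force simp: H_def Ls)
  have Hc: "H \<subseteq> carrier N" using Lc by (auto simp: H_def)
  have GH: "G \<subseteq> H"
  proof
    fix x assume "x \<in> G"
    then obtain j where j: "j < k" "x = g j" by (auto simp: g)
    have "L (\<lambda>i. if i = j then \<one>\<^bsub>R\<^esub> else \<zero>\<^bsub>R\<^esub>) = (\<Oplus>\<^bsub>N\<^esub> i\<in>{..<k}. if j = i then g i else \<zero>\<^bsub>N\<^esub>)"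
      unfolding L_def by (intro M.finsum_cong') (auto simp: Pi_def)
    also have "\<dots> = g j" using j by (intro M.add.finprod_singleton) auto
    finally have "g j = L (\<lambda>i. if i = j then \<one>\<^bsub>R\<^esub> else \<zero>\<^bsub>R\<^esub>)" ..
    then show "x \<in> H" using j(2) by (auto simp: H_def)
  qed
  have Hz: "\<zero>\<^bsub>N\<^esub> \<in> H"
  proof -
    have "L (\<lambda>_. \<zero>\<^bsub>R\<^esub>) \<in> H" by (auto simp: H_def)
    from Hs[OF R.zero_closed this] show ?thesis using Lc[of "\<lambda>_. \<zero>\<^bsub>R\<^esub>"] by auto
  qed
  have "submodule H R N"
  proof (rule submoduleI)
    fix h assume h: "h \<in> H"
    have "\<ominus>\<^bsub>N\<^esub> h = (\<ominus>\<^bsub>R\<^esub> \<one>\<^bsub>R\<^esub>) \<odot>\<^bsub>N\<^esub> h" using h Hc by (simp add: smult_l_minus subsetD)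
    then show "\<ominus>\<^bsub>N\<^esub> h \<in> H" using Hs[OF _ h] by simp
    fix h' assume h': "h' \<in> H"
    show "h \<oplus>\<^bsub>N\<^esub> h' \<in> H" using h h' by (force simp: H_def La)
  qed (use Hc Hs Hz in auto)
  then show ?thesis using GH inj by blast
qed

lemma flat_moduleD:
  fixes M :: "('a, 'b, 'k) module_scheme" and N :: "('a, 'c, 'l) module_scheme"
    and P :: "('a, 'p, 'q) module_scheme" and R :: "('a, 'm) ring_scheme"
  assumes flat: "flat_module R P" and f: "f \<in> linear_maps R M N"
    and M: "module R M" and N: "module R N" and inj: "inj_on f (carrier M)"
  shows "inj_on (tensor_map R N P f) (carrier (tensor_product R M P))"
proof -
  have P: "module R P" using flat by (simp add: flat_module_def)
  interpret M: module R M by fact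
  interpret N: module R N by fact
  have fc: "f x \<in> carrier N" if "x \<in> carrier M" for x using f that by (auto simp: linear_maps_def)
  have fa: "f (x \<oplus>\<^bsub>M\<^esub> y) = f x \<oplus>\<^bsub>N\<^esub> f y" if "x \<in> carrier M" "y \<in> carrier M" for x y
    using f that by (auto simp: linear_maps_def)
  have fs: "f (a \<odot>\<^bsub>M\<^esub> x) = a \<odot>\<^bsub>N\<^esub> f x" if "x \<in> carrier M" "a \<in> carrier R" for a x
    using f that by (auto simp: linear_maps_def)
  show ?thesis
    unfolding inj_tensor_map_iff[OF f M N P]
  proof (intro allI impI)
    fix x assume x: "Poly_Mapping.keys x \<subseteq> carrier M \<times> carrier P" and fx: "map_first f x \<in> tensor_kernel R N P"
    obtain G where G: "finite G" "G \<subseteq> carrier N"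
      and GH: "\<And>H. submodule H R N \<Longrightarrow> G \<subseteq> H \<Longrightarrow> map_first f x \<in> tensor_kernel R (N\<lparr>carrier := H\<rparr>) P"
      using tensor_kernel_finite_support[OF N P fx] by blast
    let ?D = "(\<lambda>z. f (fst z)) ` Poly_Mapping.keys x"
    have "finite (G \<union> ?D)" "G \<union> ?D \<subseteq> carrier N" using G x fc by auto
    from finite_subset_in_small_submodule[OF N this] obtain H and e :: "'c \<Rightarrow> (nat \<Rightarrow> 'a) set"
      where H: "submodule H R N" "G \<subseteq> H" "?D \<subseteq> H" and e: "inj_on e H" by auto
    note Hp = N.submoduleE[OF H(1)]
    let ?N = "N\<lparr>carrier := H\<rparr>"
    have N': "module R ?N" by (rule submodule.submodule_is_module[OF H(1) N])
    define J where "J = {u \<in> carrier M. f u \<in> H}"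
    have J: "submodule J R M"
    proof (rule M.submoduleI)
      have s: "a \<odot>\<^bsub>M\<^esub> u \<in> J" if "a \<in> carrier R" "u \<in> J" for a u
        using that Hp(4) by (auto simp: J_def fs)
      then show "\<And>a x. a \<in> carrier R \<Longrightarrow> x \<in> J \<Longrightarrow> a \<odot>\<^bsub>M\<^esub> x \<in> J" .
      have "f \<zero>\<^bsub>M\<^esub> = \<zero>\<^bsub>R\<^esub> \<odot>\<^bsub>N\<^esub> f \<zero>\<^bsub>M\<^esub>" using fs[of "\<zero>\<^bsub>M\<^esub>" "\<zero>\<^bsub>R\<^esub>"] by simp
      also have "\<dots> = \<zero>\<^bsub>N\<^esub>" using fc[of "\<zero>\<^bsub>M\<^esub>"] by simp
      also have "\<dots> \<in> H" using subgroup.one_closed[OF submodule.axioms(1)[OF H(1)]] by simp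
      finally show "\<zero>\<^bsub>M\<^esub> \<in> J" by (simp add: J_def)
      show "\<ominus>\<^bsub>M\<^esub> u \<in> J" if u: "u \<in> J" for u
      proof -
        have "\<ominus>\<^bsub>M\<^esub> u = (\<ominus>\<^bsub>R\<^esub> \<one>\<^bsub>R\<^esub>) \<odot>\<^bsub>M\<^esub> u" using u by (simp add: M.smult_l_minus J_def)
        then show ?thesis using s[OF _ u] by simp
      qed
    qed (use Hp(5) in \<open>auto simp: J_def fa\<close>)
    let ?M = "M\<lparr>carrier := J\<rparr>"
    have M': "module R ?M" by (rule submodule.submodule_is_module[OF J M])
    have xJ: "Poly_Mapping.keys x \<subseteq> J \<times> carrier P"
    proof
      fix z assume z: "z \<in> Poly_Mapping.keys x"
      then have "f (fst z) \<in> H" "fst z \<in> carrier M" "snd z \<in> carrier P" using H(3) x by auto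
      then show "z \<in> J \<times> carrier P" by (cases z) (auto simp: J_def)
    qed
    let ?e = "e \<circ> f"
    have e1: "inj_on e (carrier ?N)" using e by simp
    have e2: "inj_on ?e (carrier ?M)"
      by (rule comp_inj_on) (auto simp: J_def intro: inj_on_subset[OF inj] inj_on_subset[OF e])
    note T1 = transport[OF N' e1] and T2 = transport[OF M' e2]
    let ?TN = "transport e ?N" and ?TM = "transport ?e ?M"
    have "map_first e (map_first f x) \<in> tensor_kernel R ?TN P"
      by (rule map_first_kernel[OF T1(2) N' T1(1) P GH[OF H(1,2)]])
    then have 1: "map_first id (map_first ?e x) \<in> tensor_kernel R ?TN P" by (simp add: map_first_fmap)
    have idh: "id \<in> linear_maps R ?TM ?TN"
    proof -
      have [simp]: "inv_into J ?e (e (f u)) = u" if "u \<in> J" for u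
        using inv_into_f_f[OF e2, of u] that by simp
      have [simp]: "inv_into H e h = h'" if "h = e h'" "h' \<in> H" for h h'
        using e that by simp
      have JH: "f u \<in> H" "u \<in> carrier M" if "u \<in> J" for u using that by (auto simp: J_def)
      show ?thesis using JH
        by (auto simp: linear_maps_def transport_def fa fs)
    qed
    have "inj_on (tensor_map R ?TN P id) (carrier (tensor_product R ?TM P))"
      using flat idh T1(1) T2(1) unfolding flat_module_def by auto
    then have "map_first ?e x \<in> tensor_kernel R ?TM P"
      using 1 keys_fmap[OF xJ, of ?e "carrier ?TM"] T2(4)
      unfolding inj_tensor_map_iff[OF idh T2(1) T1(1) P] by auto
    then have "map_first (inv_into J ?e) (map_first ?e x) \<in> tensor_kernel R ?M P"
      using map_first_kernel[OF T2(3) T2(1) M' P] by simp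
    moreover have "map_first (inv_into J ?e) (map_first ?e x) = map_first id x"
      unfolding map_first_fmap using xJ inv_into_f_f[OF e2] by (intro map_first_cong) auto
    ultimately have "map_first id x \<in> tensor_kernel R ?M P" by simp
    moreover have "id \<in> linear_maps R ?M M" by (auto simp: linear_maps_def J_def)
    ultimately have "map_first id (map_first id x) \<in> tensor_kernel R M P" by (intro map_first_kernel[OF _ M' M P])
    then show "x \<in> tensor_kernel R M P" by (simp add: map_first_id)
  qed
qed

end

theory Submission
  imports Defs
begin

text \<open>
  Over a chain ring S every module P considered here is uniserial: of two elements of P one is a
  multiple of the other. Then all tensors in \<open>M \<otimes> P\<close> are pure, and testing flatness on the
  inclusion of a principal ideal \<open>rS\<close> into S turns out to suffice: P is flat iff \<open>r x = 0\<close>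
  always has a reason in S, that is, \<open>x = s y\<close> for some y in P and some s in S with \<open>r s = 0\<close>
  (\<open>flat_uniserial_iff\<close>). For an ideal I over \<open>R/(0:I)\<close> the condition reads: if \<open>r x = 0\<close> with
  r in R and x in I, then \<open>x = s y\<close> with y in I and \<open>r s I = 0\<close> (\<open>flat_criterion\<close>).

  Suppose that all ideals meet this condition, and apply it to the nilradical N. A zerodivisor z
  outside N kills some nonzero x, which lies in N because N is prime; hence \<open>x = s y\<close> with y in N
  and \<open>z s N = 0\<close>. But z does not lie in the prime ideal N, so it divides y within N, and
  therefore \<open>x = s y\<close> lies in \<open>z s N = 0\<close>, which is absurd. This direction is
  \<open>zerodivisors_subset_nilradical\<close>.

  Now suppose \<open>Z = N\<close>, and let \<open>r x = 0\<close> with \<open>r I \<noteq> 0\<close> and x nonzero in I. The candidate for y is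
  an element that almost generates I; it exists because zerodivisors are nilpotent
  (\<open>exists_not_nilpotent_multiple\<close>). If Z differs from its square, then Z is generated up to
  regular elements by one nilpotent element, there is an element y of I outside \<open>Z I\<close>, and such
  an element generates I up to regular elements, which makes \<open>r s I\<close> vanish together with
  \<open>r s y\<close>. If Q is not coherent, then no annihilator of a nonzero zerodivisor becomes principal
  in Q (\<open>annihilators_principal_up_to_regular\<close>, \<open>coherent_localization\<close>), so that \<open>x = q x'\<close> with
  q nilpotent and still \<open>r x' = 0\<close>. Any y in I outside \<open>q I\<close> satisfies \<open>q I \<subseteq> R y\<close>, and comparing
  \<open>x'\<close> with this y gives the factorization of x: the factor q is the slack that pays for y
  generating I only approximately.
\<close>


section \<open>Zerodivisors and nilpotent elements of chain rings\<close>

text \<open>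
  Divisibility of elements is what can be checked in quotients and localizations.
\<close>

lemma chain_ringI:
  fixes R (structure)
  assumes "cring R"
    and total: "\<And>a b. a \<in> carrier R \<Longrightarrow> b \<in> carrier R \<Longrightarrow>
      (\<exists>c\<in>carrier R. a = c \<otimes> b) \<or> (\<exists>c\<in>carrier R. b = c \<otimes> a)"
  shows "chain_ring R"
proof -
  interpret cring R by fact
  show ?thesis
  proof unfold_locales
    fix I J assume I: "ideal I R" and J: "ideal J R"
    interpret I: ideal I R by fact
    interpret J: ideal J R by fact
    show "I \<subseteq> J \<or> J \<subseteq> I"
    proof (rule disjCI, rule subsetI)
      fix b assume n: "\<not> J \<subseteq> I" and b: "b \<in> I"
      then obtain a where a: "a \<in> J" "a \<notin> I" by auto
      from total[of a b] a b show "b \<in> J"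
        using I.I_l_closed J.I_l_closed I.Icarr J.Icarr by metis
    qed
  qed
qed

context chain_ring
begin

lemma divides_total:
  assumes "a \<in> carrier R" "b \<in> carrier R"
  obtains c where "c \<in> carrier R" "a = c \<otimes> b" | c where "c \<in> carrier R" "b = c \<otimes> a"
proof -
  have "a \<in> PIdl a" "b \<in> PIdl b" using assms by (auto intro: cgenideal_self)
  moreover have "PIdl a \<subseteq> PIdl b \<or> PIdl b \<subseteq> PIdl a"
    using assms by (intro ideals_total cgenideal_ideal)
  ultimately have "a \<in> PIdl b \<or> b \<in> PIdl a" by auto
  then show thesis using that by (auto simp: cgenideal_def)
qed

lemma zerodivisorsE:
  assumes "z \<in> zerodivisors R" "z \<noteq> \<zero>"
  obtains x where "x \<in> carrier R" "x \<noteq> \<zero>" "z \<otimes> x = \<zero>"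
  using assms by (auto simp: zerodivisors_def)

lemma regular_cancel:
  assumes "c \<in> carrier R - zerodivisors R" "x \<in> carrier R" "c \<otimes> x = \<zero>"
  shows "x = \<zero>"
  using assms by (auto simp: zerodivisors_def)

lemma regular_mult:
  assumes "c \<in> carrier R - zerodivisors R" "d \<in> carrier R - zerodivisors R"
  shows "c \<otimes> d \<in> carrier R - zerodivisors R"
proof -
  have cd: "c \<in> carrier R" "d \<in> carrier R" using assms by auto
  have "d \<noteq> \<zero>" using assms by (auto simp: zerodivisors_def)
  then have "c \<otimes> d \<noteq> \<zero>" using regular_cancel assms by blast
  moreover have "x = \<zero>" if "x \<in> carrier R" "c \<otimes> d \<otimes> x = \<zero>" for x
    using that cd regular_cancel[OF assms(1), of "d \<otimes> x"] regular_cancel[OF assms(2), of x]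
    by (simp add: m_assoc)
  ultimately show ?thesis using cd by (auto simp: zerodivisors_def)
qed

lemma regular_one: "\<one> \<noteq> \<zero> \<Longrightarrow> \<one> \<in> carrier R - zerodivisors R"
  by (auto simp: zerodivisors_def)

lemma nilradical_mult:
  assumes "x \<in> nilradical R" "a \<in> carrier R"
  shows "a \<otimes> x \<in> nilradical R"
proof -
  obtain n :: nat where x: "x \<in> carrier R" "x [^] n = \<zero>" using assms by (auto simp: nilradical_def)
  then have "(a \<otimes> x) [^] n = \<zero>" using assms by (simp add: nat_pow_distrib)
  then show ?thesis using x assms by (auto simp: nilradical_def)
qed

lemma ideal_nilradical: "ideal (nilradical R) R"
proof (rule idealI[OF ring_axioms])
  show "subgroup (nilradical R) (add_monoid R)"
  proof (rule add.subgroupI)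
    show "nilradical R \<subseteq> carrier R" by (auto simp: nilradical_def)
    have "\<zero> [^] (1::nat) = \<zero>" by simp
    then have "\<zero> \<in> nilradical R" unfolding nilradical_def by blast
    then show "nilradical R \<noteq> {}" by blast
  next
    fix x assume "x \<in> nilradical R"
    then show "\<ominus> x \<in> nilradical R"
      using nilradical_mult[of x "\<ominus> \<one>"] by (simp add: nilradical_def l_minus)
  next
    fix x y assume x: "x \<in> nilradical R" and y: "y \<in> nilradical R"
    then have xy: "x \<in> carrier R" "y \<in> carrier R" by (auto simp: nilradical_def)
    then show "x \<oplus> y \<in> nilradical R"
    proof (cases rule: divides_total)
      case (1 c)
      then have "x \<oplus> y = (c \<oplus> \<one>) \<otimes> y" using xy by (simp add: l_distr)
      then show ?thesis using nilradical_mult[OF y, of "c \<oplus> \<one>"] 1 by simp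
    next
      case (2 c)
      then have "x \<oplus> y = (\<one> \<oplus> c) \<otimes> x" using xy by (simp add: l_distr)
      then show ?thesis using nilradical_mult[OF x, of "\<one> \<oplus> c"] 2 by simp
    qed
  qed
next
  fix x a assume x: "x \<in> nilradical R" and a: "a \<in> carrier R"
  then have "x \<otimes> a = a \<otimes> x" by (simp add: nilradical_def m_comm)
  then show "a \<otimes> x \<in> nilradical R" "x \<otimes> a \<in> nilradical R" using nilradical_mult[OF x a] by auto
qed

lemma nilradical_sq:
  assumes "a \<in> carrier R" "a \<otimes> a \<in> nilradical R"
  shows "a \<in> nilradical R"
proof -
  obtain n :: nat where "(a \<otimes> a) [^] n = \<zero>" using assms by (auto simp: nilradical_def)
  then have "a [^] (n + n) = \<zero>" using assms by (simp add: nat_pow_distrib nat_pow_mult)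
  then show ?thesis using assms by (auto simp: nilradical_def)
qed

text \<open>
  If a divides b, then the product \<open>a b\<close> divides \<open>b\<^sup>2\<close>.
\<close>

lemma nilradical_prime:
  assumes a: "a \<in> carrier R" and b: "b \<in> carrier R" and ab: "a \<otimes> b \<in> nilradical R"
  shows "a \<in> nilradical R \<or> b \<in> nilradical R"
  using a b
proof (cases rule: divides_total)
  case (1 c)
  then have "a \<otimes> a = c \<otimes> (a \<otimes> b)" using a b by (simp add: m_ac)
  then show ?thesis using nilradical_mult[OF ab 1(1)] nilradical_sq[OF a] by simp
next
  case (2 c)
  then have "b \<otimes> b = c \<otimes> (a \<otimes> b)" using a b by (simp add: m_ac)
  then show ?thesis using nilradical_mult[OF ab 2(1)] nilradical_sq[OF b] by simp
qed

lemma nilradical_subset_zerodivisors: "nilradical R \<subseteq> zerodivisors R"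
proof
  fix x assume "x \<in> nilradical R"
  then obtain n :: nat where x: "x \<in> carrier R" and n: "x [^] n = \<zero>" by (auto simp: nilradical_def)
  show "x \<in> zerodivisors R"
  proof (rule ccontr)
    assume "x \<notin> zerodivisors R"
    then have r: "x \<in> carrier R - zerodivisors R" using x by simp
    have "x [^] m \<noteq> \<zero>" for m :: nat
    proof (induction m)
      case 0
      have "x \<noteq> \<zero>" using r by (auto simp: zerodivisors_def)
      then have "\<one> \<noteq> \<zero>" using x l_one l_null by metis
      then show ?case by simp
    next
      case (Suc m)
      have "x [^] Suc m = x \<otimes> x [^] m" using x by (simp add: m_comm)
      then show ?case using regular_cancel[OF r, of "x [^] m"] Suc x by auto
    qed
    from this[of n] n show False by simp
  qed
qed

end


section \<open>Tensoring with uniserial modules over chain rings\<close>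

lemma module_ideal_module:
  fixes R (structure)
  assumes "cring R" "ideal I R"
  shows "module R (ideal_module R I)"
proof -
  interpret cring R by fact
  interpret I: ideal I R by fact
  show ?thesis
  proof (rule moduleI)
    show "abelian_group (ideal_module R I)"
    proof (rule abelian_groupI)
      fix x assume "x \<in> carrier (ideal_module R I)"
      then have "\<ominus> x \<in> I" "\<ominus> x \<oplus> x = \<zero>" by (auto simp: ideal_module_def I.Icarr l_neg)
      then show "\<exists>y\<in>carrier (ideal_module R I). y \<oplus>\<^bsub>ideal_module R I\<^esub> x = \<zero>\<^bsub>ideal_module R I\<^esub>"
        by (auto simp: ideal_module_def)
    qed (simp_all add: ideal_module_def I.Icarr a_ac)
  qed (use assms(1) in \<open>auto simp: ideal_module_def I.Icarr I.I_l_closed l_distr r_distr m_assoc\<close>)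
qed

text \<open>
  In terms of submodules: the submodules of P form a chain.
\<close>

definition uniserial :: "('a, 'm) ring_scheme \<Rightarrow> ('a, 'b, 'k) module_scheme \<Rightarrow> bool" where
  "uniserial S P \<longleftrightarrow> (\<forall>x\<in>carrier P. \<forall>y\<in>carrier P.
     (\<exists>a\<in>carrier S. x = a \<odot>\<^bsub>P\<^esub> y) \<or> (\<exists>a\<in>carrier S. y = a \<odot>\<^bsub>P\<^esub> x))"

lemma uniserial_finite_common_multiple:
  assumes P: "module S P" and uni: "uniserial S P" and "finite G" "G \<subseteq> carrier P"
  shows "\<exists>y\<in>carrier P. \<forall>x\<in>G. \<exists>a\<in>carrier S. x = a \<odot>\<^bsub>P\<^esub> y"
  using assms(3,4)
proof (induction rule: finite_induct)
  interpret P: module S P by fact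
  case empty
  show ?case by (intro bexI[of _ "\<zero>\<^bsub>P\<^esub>"]) auto
next
  interpret P: module S P by fact
  case (insert z G)
  then obtain y where y: "y \<in> carrier P" "\<forall>x\<in>G. \<exists>a\<in>carrier S. x = a \<odot>\<^bsub>P\<^esub> y" by auto
  have z: "z \<in> carrier P" using insert by simp
  from uni y(1) z consider a where "a \<in> carrier S" "z = a \<odot>\<^bsub>P\<^esub> y" | a where "a \<in> carrier S" "y = a \<odot>\<^bsub>P\<^esub> z"
    unfolding uniserial_def by blast
  then show ?case
  proof cases
    case 1
    then show ?thesis using y by (intro bexI[of _ y]) auto
  next
    case (2 a)
    have "\<exists>c\<in>carrier S. x = c \<odot>\<^bsub>P\<^esub> z" if x: "x \<in> G" for x
    proof -
      obtain c where "c \<in> carrier S" "x = c \<odot>\<^bsub>P\<^esub> y" using y(2) x by blast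
      then show ?thesis using 2 z by (intro bexI[of _ "c \<otimes>\<^bsub>S\<^esub> a"]) (auto simp: P.smult_assoc1)
    qed
    moreover have "z = \<one>\<^bsub>S\<^esub> \<odot>\<^bsub>P\<^esub> z" using z by simp
    ultimately show ?thesis using z P.R.one_closed by (intro bexI[of _ z]) blast+
  qed
qed

lemma hom_free_Abelian_group_arith:
  assumes N: "abelian_group N" and h: "h \<in> hom (free_Abelian_group B) (add_monoid N)"
    and u: "Poly_Mapping.keys u \<subseteq> B" and v: "Poly_Mapping.keys v \<subseteq> B"
  shows "h (u - v) = h u \<ominus>\<^bsub>N\<^esub> h v" "h (- v) = \<ominus>\<^bsub>N\<^esub> h v" "h u \<in> carrier N" "h 0 = \<zero>\<^bsub>N\<^esub>"
    "h (u + v) = h u \<oplus>\<^bsub>N\<^esub> h v"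
proof -
  interpret N: abelian_group N by fact
  interpret h: group_hom "free_Abelian_group B" "add_monoid N" h
    using h N.a_group by (simp add: group_hom_def group_hom_axioms_def)
  show m: "h (- v) = \<ominus>\<^bsub>N\<^esub> h v" using h.hom_inv[of v] v by (simp add: a_inv_def)
  show a: "h (u + v) = h u \<oplus>\<^bsub>N\<^esub> h v" using h.hom_mult[of u v] u v by simp
  show "h u \<in> carrier N" using h.hom_closed[of u] u by simp
  show "h 0 = \<zero>\<^bsub>N\<^esub>" using h.hom_one by simp
  have "h (u + - v) = h u \<oplus>\<^bsub>N\<^esub> h (- v)" using h.hom_mult[of u "- v"] u v by simp
  then show "h (u - v) = h u \<ominus>\<^bsub>N\<^esub> h v" using m by (simp add: a_minus_def)
qed

text \<open>
  The isomorphism of \<open>N \<otimes> S y0\<close> with \<open>N/(0:y0)N\<close>, lifted to formal sums: b picks coefficients with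
  respect to y0, and h sends \<open>n \<otimes> y\<close> to \<open>b(y) n\<close>, which is well defined modulo a subgroup K
  containing \<open>(0:y0)N\<close>. Since h has to be additive on all formal sums, b is defined on all of P;
  its values are meaningful only at the multiples of y0.
\<close>

definition cyclic_evaluation :: "('a, 'm) ring_scheme \<Rightarrow> ('a, 'b, 'k) module_scheme \<Rightarrow>
    ('a, 'c, 'l) module_scheme \<Rightarrow> 'c \<Rightarrow> ('c \<Rightarrow> 'a) \<Rightarrow> 'b set \<Rightarrow> (('b \<times> 'c \<Rightarrow>\<^sub>0 int) \<Rightarrow> 'b) \<Rightarrow> bool" where
  "cyclic_evaluation S N P y0 b K h \<longleftrightarrow> y0 \<in> carrier P \<and> b \<in> carrier P \<rightarrow> carrier S \<and>
     subgroup K (add_monoid N) \<and>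
     (\<forall>r\<in>carrier S. \<forall>n\<in>carrier N. r \<odot>\<^bsub>P\<^esub> y0 = \<zero>\<^bsub>P\<^esub> \<longrightarrow> r \<odot>\<^bsub>N\<^esub> n \<in> K) \<and>
     h \<in> hom (free_Abelian_group (carrier N \<times> carrier P)) (add_monoid N) \<and>
     (\<forall>n\<in>carrier N. \<forall>y\<in>carrier P. h (frag_of (n, y)) = b y \<odot>\<^bsub>N\<^esub> n)"

text \<open>
  Each relator involves at most three elements of P. Once these are multiples of y0, the
  coefficients that b assigns to them satisfy the same relation as the elements do, up to a
  coefficient that annihilates y0.
\<close>

lemma cyclic_evaluation_relator:
  assumes N: "module S N" and P: "module S P" and r: "r \<in> tensor_relators S N P"
  shows "\<exists>G. finite G \<and> G \<subseteq> carrier P \<and> (\<forall>y0 b K h. cyclic_evaluation S N P y0 b K h \<longrightarrow>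
    (\<forall>y\<in>G. y = b y \<odot>\<^bsub>P\<^esub> y0) \<longrightarrow> h r \<in> K)"
proof -
  interpret N: module S N by fact
  interpret P: module S P by fact
  have ev: "y0 \<in> carrier P" "y \<in> carrier P \<Longrightarrow> b y \<in> carrier S" "\<zero>\<^bsub>N\<^esub> \<in> K"
     "c \<in> carrier S \<Longrightarrow> n \<in> carrier N \<Longrightarrow> c \<odot>\<^bsub>P\<^esub> y0 = \<zero>\<^bsub>P\<^esub> \<Longrightarrow> c \<odot>\<^bsub>N\<^esub> n \<in> K"
     "n \<in> carrier N \<Longrightarrow> y \<in> carrier P \<Longrightarrow> h (frag_of (n, y)) = b y \<odot>\<^bsub>N\<^esub> n"
     "Poly_Mapping.keys u \<subseteq> carrier N \<times> carrier P \<Longrightarrow> Poly_Mapping.keys v \<subseteq> carrier N \<times> carrier P \<Longrightarrow>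
       h (u - v) = h u \<ominus>\<^bsub>N\<^esub> h v"
    if "cyclic_evaluation S N P y0 b K h" for y0 b K h y c n u v
    using that hom_free_Abelian_group_arith(1)[OF N.M.abelian_group_axioms, of h "carrier N \<times> carrier P" u v]
      subgroup.one_closed[of K "add_monoid N"]
    unfolding cyclic_evaluation_def by auto
  have kd: "Poly_Mapping.keys (frag_of p - frag_of q) \<subseteq> carrier N \<times> carrier P"
    if "p \<in> carrier N \<times> carrier P" "q \<in> carrier N \<times> carrier P" for p q
    using that keys_diff[of "frag_of p" "frag_of q"] by (auto simp: keys_frag_of)
  from r consider 
     (1) x x' y where "r = frag_of (x \<oplus>\<^bsub>N\<^esub> x', y) - frag_of (x, y) - frag_of (x', y)" "x \<in> carrier N" "x' \<in> carrier N" "y \<in> carrier P"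
   | (2) x y y' where "r = frag_of (x, y \<oplus>\<^bsub>P\<^esub> y') - frag_of (x, y) - frag_of (x, y')" "x \<in> carrier N" "y \<in> carrier P" "y' \<in> carrier P"
   | (3) a x y where "r = frag_of (a \<odot>\<^bsub>N\<^esub> x, y) - frag_of (x, a \<odot>\<^bsub>P\<^esub> y)" "a \<in> carrier S" "x \<in> carrier N" "y \<in> carrier P"
    unfolding tensor_relators_def by blast
  then show ?thesis
  proof cases
    case 1
    have "h r \<in> K" if e: "cyclic_evaluation S N P y0 b K h" for y0 b K h
    proof -
      let ?b = "b y"
      have b: "?b \<in> carrier S" using ev(2)[OF e] 1 by simp
      have "h r = ?b \<odot>\<^bsub>N\<^esub> (x \<oplus>\<^bsub>N\<^esub> x') \<ominus>\<^bsub>N\<^esub> ?b \<odot>\<^bsub>N\<^esub> x \<ominus>\<^bsub>N\<^esub> ?b \<odot>\<^bsub>N\<^esub> x'"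
        using 1 kd by (simp add: ev(5,6)[OF e] keys_frag_of)
      also have "\<dots> = \<zero>\<^bsub>N\<^esub>"
        using 1 b by (simp add: N.smult_r_distr a_minus_def N.M.a_ac N.M.r_neg N.M.r_neg1)
      finally show ?thesis using ev(3)[OF e] by simp
    qed
    then show ?thesis by (intro exI[of _ "{}"]) auto
  next
    case 2
    have "h r \<in> K" if e: "cyclic_evaluation S N P y0 b K h"
      and G: "\<forall>y\<in>{y, y', y \<oplus>\<^bsub>P\<^esub> y'}. y = b y \<odot>\<^bsub>P\<^esub> y0" for y0 b K h
    proof -
      let ?c = "b (y \<oplus>\<^bsub>P\<^esub> y') \<ominus>\<^bsub>S\<^esub> b y \<ominus>\<^bsub>S\<^esub> b y'"
      have b: "b y \<in> carrier S" "b y' \<in> carrier S" "b (y \<oplus>\<^bsub>P\<^esub> y') \<in> carrier S" using ev(2)[OF e] 2 by auto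
      have y0: "y0 \<in> carrier P" by (rule ev(1)[OF e])
      have sub: "(c \<ominus>\<^bsub>S\<^esub> d \<ominus>\<^bsub>S\<^esub> d') \<odot>\<^bsub>P\<^esub> y0 = c \<odot>\<^bsub>P\<^esub> y0 \<ominus>\<^bsub>P\<^esub> d \<odot>\<^bsub>P\<^esub> y0 \<ominus>\<^bsub>P\<^esub> d' \<odot>\<^bsub>P\<^esub> y0"
        if "c \<in> carrier S" "d \<in> carrier S" "d' \<in> carrier S" for c d d'
        using that y0 by (simp add: P.smult_l_distr P.smult_l_minus a_minus_def a_minus_def)
      have "?c \<odot>\<^bsub>P\<^esub> y0 = (y \<oplus>\<^bsub>P\<^esub> y') \<ominus>\<^bsub>P\<^esub> y \<ominus>\<^bsub>P\<^esub> y'"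
        unfolding sub[OF b(3,1,2)] using G by simp
      also have "\<dots> = \<zero>\<^bsub>P\<^esub>"
        using 2 by (simp add: a_minus_def P.M.a_ac P.M.r_neg P.M.r_neg1)
      finally have c: "?c \<odot>\<^bsub>P\<^esub> y0 = \<zero>\<^bsub>P\<^esub>" .
      have "h r = b (y \<oplus>\<^bsub>P\<^esub> y') \<odot>\<^bsub>N\<^esub> x \<ominus>\<^bsub>N\<^esub> b y \<odot>\<^bsub>N\<^esub> x \<ominus>\<^bsub>N\<^esub> b y' \<odot>\<^bsub>N\<^esub> x"
        using 2 kd by (simp add: ev(5,6)[OF e] keys_frag_of)
      also have "\<dots> = ?c \<odot>\<^bsub>N\<^esub> x"
        using 2 b by (simp add: N.smult_l_distr N.smult_l_minus a_minus_def a_minus_def)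
      finally show ?thesis using ev(4)[OF e _ _ c] 2 b by simp
    qed
    then show ?thesis using 2 by (intro exI[of _ "{y, y', y \<oplus>\<^bsub>P\<^esub> y'}"]) auto
  next
    case 3
    have "h r \<in> K" if e: "cyclic_evaluation S N P y0 b K h"
      and G: "\<forall>y\<in>{y, a \<odot>\<^bsub>P\<^esub> y}. y = b y \<odot>\<^bsub>P\<^esub> y0" for y0 b K h
    proof -
      let ?c = "a \<otimes>\<^bsub>S\<^esub> b y \<ominus>\<^bsub>S\<^esub> b (a \<odot>\<^bsub>P\<^esub> y)"
      have b: "b y \<in> carrier S" "b (a \<odot>\<^bsub>P\<^esub> y) \<in> carrier S" using ev(2)[OF e] 3 by auto
      have y0: "y0 \<in> carrier P" by (rule ev(1)[OF e])
      have sub: "(a \<otimes>\<^bsub>S\<^esub> c \<ominus>\<^bsub>S\<^esub> d) \<odot>\<^bsub>P\<^esub> y0 = a \<odot>\<^bsub>P\<^esub> (c \<odot>\<^bsub>P\<^esub> y0) \<ominus>\<^bsub>P\<^esub> d \<odot>\<^bsub>P\<^esub> y0"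
        if "c \<in> carrier S" "d \<in> carrier S" for c d
        using that y0 3(2) by (simp add: P.smult_l_distr P.smult_l_minus a_minus_def a_minus_def P.smult_assoc1)
      have "?c \<odot>\<^bsub>P\<^esub> y0 = a \<odot>\<^bsub>P\<^esub> y \<ominus>\<^bsub>P\<^esub> a \<odot>\<^bsub>P\<^esub> y"
        unfolding sub[OF b] using G by simp
      also have "\<dots> = \<zero>\<^bsub>P\<^esub>" using 3 by (simp add: a_minus_def P.M.r_neg)
      finally have c: "?c \<odot>\<^bsub>P\<^esub> y0 = \<zero>\<^bsub>P\<^esub>" .
      have "h r = b y \<odot>\<^bsub>N\<^esub> (a \<odot>\<^bsub>N\<^esub> x) \<ominus>\<^bsub>N\<^esub> b (a \<odot>\<^bsub>P\<^esub> y) \<odot>\<^bsub>N\<^esub> x"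
        using 3 by (simp add: ev(5,6)[OF e] keys_frag_of)
      also have "b y \<odot>\<^bsub>N\<^esub> (a \<odot>\<^bsub>N\<^esub> x) = (a \<otimes>\<^bsub>S\<^esub> b y) \<odot>\<^bsub>N\<^esub> x"
        using 3 b by (simp add: N.smult_assoc1[symmetric] N.R.m_comm)
      also have "(a \<otimes>\<^bsub>S\<^esub> b y) \<odot>\<^bsub>N\<^esub> x \<ominus>\<^bsub>N\<^esub> b (a \<odot>\<^bsub>P\<^esub> y) \<odot>\<^bsub>N\<^esub> x = ?c \<odot>\<^bsub>N\<^esub> x"
        using 3 b by (simp add: N.smult_l_distr N.smult_l_minus a_minus_def a_minus_def)
      finally show ?thesis using ev(4)[OF e _ _ c] 3 b by simp
    qed
    then show ?thesis using 3 by (intro exI[of _ "{y, a \<odot>\<^bsub>P\<^esub> y}"]) auto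
  qed
qed

text \<open>
  A proof that a formal sum vanishes in \<open>N \<otimes> P\<close> uses only finitely many elements of P; it remains
  a proof over any cyclic submodule that contains all of them.
\<close>

lemma cyclic_evaluation_kernel:
  assumes N: "module S N" and P: "module S P" and x: "x \<in> tensor_kernel S N P"
  shows "\<exists>G. finite G \<and> G \<subseteq> carrier P \<and> (\<forall>y0 b K h. cyclic_evaluation S N P y0 b K h \<longrightarrow>
    (\<forall>y\<in>G. y = b y \<odot>\<^bsub>P\<^esub> y0) \<longrightarrow> h x \<in> K)" (is "\<exists>G. ?E x G")
proof -
  interpret N: module S N by fact
  have ev: "subgroup K (add_monoid N)" "h \<in> hom (free_Abelian_group (carrier N \<times> carrier P)) (add_monoid N)"
    if "cyclic_evaluation S N P y0 b K h" for y0 b K h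
    using that unfolding cyclic_evaluation_def by auto
  have "Poly_Mapping.keys x \<subseteq> carrier N \<times> carrier P \<and> (\<exists>G. ?E x G)"
    using N P x
  proof (induction rule: tensor_kernel_induct)
    case zero
    have "h 0 \<in> K" if e: "cyclic_evaluation S N P y0 b K h" for y0 b K h
      using hom_free_Abelian_group_arith(4)[OF N.M.abelian_group_axioms ev(2)[OF e], of 0 0] subgroup.one_closed[OF ev(1)[OF e]]
      by simp
    then show ?case by (auto intro!: exI[of _ "{}"])
  next
    case (relator r)
    then show ?case using cyclic_evaluation_relator[OF N P] keys_tensor_relators[OF N P] by blast
  next
    case (minus x)
    then obtain G where k: "Poly_Mapping.keys x \<subseteq> carrier N \<times> carrier P" and G: "?E x G" by blast
    have "h (- x) \<in> K" if e: "cyclic_evaluation S N P y0 b K h" and "\<forall>y\<in>G. y = b y \<odot>\<^bsub>P\<^esub> y0" for y0 b K h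
    proof -
      have "h x \<in> K" using G that by blast
      then have "\<ominus>\<^bsub>N\<^esub> h x \<in> K" using subgroup.m_inv_closed[OF ev(1)[OF e]] by (simp add: a_inv_def)
      then show ?thesis using hom_free_Abelian_group_arith(2)[OF N.M.abelian_group_axioms ev(2)[OF e] k k] by simp
    qed
    then show ?case using k G by (intro conjI exI[of _ G]) auto
  next
    case (add x y)
    then obtain G G' where k: "Poly_Mapping.keys x \<subseteq> carrier N \<times> carrier P" "Poly_Mapping.keys y \<subseteq> carrier N \<times> carrier P"
      and G: "?E x G" "?E y G'" by blast
    have "h (x + y) \<in> K" if e: "cyclic_evaluation S N P y0 b K h"
      and b: "\<forall>y\<in>G \<union> G'. y = b y \<odot>\<^bsub>P\<^esub> y0" for y0 b K h
    proof -
      have "h x \<in> K" "h y \<in> K" using G e b by blast+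
      then have "h x \<oplus>\<^bsub>N\<^esub> h y \<in> K" using subgroup.m_closed[OF ev(1)[OF e]] by simp
      then show ?thesis using hom_free_Abelian_group_arith(5)[OF N.M.abelian_group_axioms ev(2)[OF e] k] by simp
    qed
    moreover have "Poly_Mapping.keys (x + y) \<subseteq> carrier N \<times> carrier P" using k keys_add[of x y] by blast
    ultimately show ?case using G by (intro conjI exI[of _ "G \<union> G'"]) auto
  qed
  then show ?thesis by blast
qed

text \<open>
  As P is the directed union of its cyclic submodules, \<open>n \<otimes> y = 0\<close> is already true in some
  \<open>N \<otimes> S y0 = N/(0:y0)N\<close>. The elements of \<open>(0:y0)N\<close> are single products because \<open>(0:y0)\<close> is an
  ideal of a chain ring.
\<close>

lemma pure_tensor_vanishes:
  assumes S: "chain_ring S" and N: "module S N" and P: "module S P" and uni: "uniserial S P"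
    and n: "n \<in> carrier N" and y: "y \<in> carrier P" and ker: "frag_of (n, y) \<in> tensor_kernel S N P"
  shows "\<exists>y0\<in>carrier P. \<exists>b\<in>carrier S. \<exists>r\<in>carrier S. \<exists>n'\<in>carrier N.
    y = b \<odot>\<^bsub>P\<^esub> y0 \<and> r \<odot>\<^bsub>P\<^esub> y0 = \<zero>\<^bsub>P\<^esub> \<and> b \<odot>\<^bsub>N\<^esub> n = r \<odot>\<^bsub>N\<^esub> n'"
proof -
  interpret S: chain_ring S by fact
  interpret N: module S N by fact
  interpret P: module S P by fact
  obtain G where G: "finite G" "G \<subseteq> carrier P"
    "\<And>y0 b K h. cyclic_evaluation S N P y0 b K h \<Longrightarrow> \<forall>y\<in>G. y = b y \<odot>\<^bsub>P\<^esub> y0 \<Longrightarrow> h (frag_of (n, y)) \<in> K"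
    using cyclic_evaluation_kernel[OF N P ker] by blast
  obtain y0 where y0: "y0 \<in> carrier P" "\<forall>x\<in>insert y G. \<exists>a\<in>carrier S. x = a \<odot>\<^bsub>P\<^esub> y0"
    using uniserial_finite_common_multiple[OF P uni, of "insert y G"] G y by auto
  then have "\<forall>x. \<exists>a\<in>carrier S. x \<in> insert y G \<longrightarrow> x = a \<odot>\<^bsub>P\<^esub> y0" using S.zero_closed by blast
  then obtain b where b: "\<And>x. b x \<in> carrier S" "\<And>x. x \<in> insert y G \<Longrightarrow> x = b x \<odot>\<^bsub>P\<^esub> y0" by metis
  define K where "K = {r \<odot>\<^bsub>N\<^esub> m | r m. r \<in> carrier S \<and> m \<in> carrier N \<and> r \<odot>\<^bsub>P\<^esub> y0 = \<zero>\<^bsub>P\<^esub>}"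
  have KI: "r \<odot>\<^bsub>N\<^esub> m \<in> K" if "r \<in> carrier S" "m \<in> carrier N" "r \<odot>\<^bsub>P\<^esub> y0 = \<zero>\<^bsub>P\<^esub>" for r m
    using that unfolding K_def by blast
  have K: "subgroup K (add_monoid N)"
  proof (rule N.M.add.subgroupI)
    show "K \<subseteq> carrier N" by (auto simp: K_def)
    show "K \<noteq> {}" using KI[of "\<zero>\<^bsub>S\<^esub>" n] n y0 by auto
    show "\<ominus>\<^bsub>N\<^esub> k \<in> K" if kK: "k \<in> K" for k
    proof -
      obtain r m where k: "k = r \<odot>\<^bsub>N\<^esub> m" "r \<in> carrier S" "m \<in> carrier N" "r \<odot>\<^bsub>P\<^esub> y0 = \<zero>\<^bsub>P\<^esub>"
        using kK unfolding K_def by blast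
      then have "\<ominus>\<^bsub>N\<^esub> k = r \<odot>\<^bsub>N\<^esub> (\<ominus>\<^bsub>N\<^esub> m)" by (simp add: N.smult_r_minus)
      then show ?thesis using KI[of r "\<ominus>\<^bsub>N\<^esub> m"] k by simp
    qed
    show "k \<oplus>\<^bsub>N\<^esub> k' \<in> K" if kK: "k \<in> K" "k' \<in> K" for k k'
    proof -
      obtain r m where k: "k = r \<odot>\<^bsub>N\<^esub> m" "r \<in> carrier S" "m \<in> carrier N" "r \<odot>\<^bsub>P\<^esub> y0 = \<zero>\<^bsub>P\<^esub>"
        using kK unfolding K_def by blast
      obtain r' m' where k': "k' = r' \<odot>\<^bsub>N\<^esub> m'" "r' \<in> carrier S" "m' \<in> carrier N" "r' \<odot>\<^bsub>P\<^esub> y0 = \<zero>\<^bsub>P\<^esub>"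
        using kK unfolding K_def by blast
      from k(2) k'(2) show ?thesis
      proof (cases rule: S.divides_total)
        case (1 c)
        then have "k \<oplus>\<^bsub>N\<^esub> k' = r' \<odot>\<^bsub>N\<^esub> (c \<odot>\<^bsub>N\<^esub> m \<oplus>\<^bsub>N\<^esub> m')"
          using k k' by (simp add: N.smult_r_distr N.smult_assoc1[symmetric] S.m_comm)
        then show ?thesis using KI[OF k'(2) _ k'(4)] k k' 1 by simp
      next
        case (2 c)
        then have "k \<oplus>\<^bsub>N\<^esub> k' = r \<odot>\<^bsub>N\<^esub> (m \<oplus>\<^bsub>N\<^esub> c \<odot>\<^bsub>N\<^esub> m')"
          using k k' by (simp add: N.smult_r_distr N.smult_assoc1[symmetric] S.m_comm)
        then show ?thesis using KI[OF k(2) _ k(4)] k k' 2 by simp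
      qed
    qed
  qed
  have im: "(\<lambda>(m, z). b z \<odot>\<^bsub>N\<^esub> m) ` (carrier N \<times> carrier P) \<subseteq> carrier (add_monoid N)"
    using b(1) by auto
  obtain h
    where h: "h \<in> hom (free_Abelian_group (carrier N \<times> carrier P)) (add_monoid N)"
    "\<And>x. x \<in> carrier N \<times> carrier P \<Longrightarrow> h (frag_of x) = (\<lambda>(m, z). b z \<odot>\<^bsub>N\<^esub> m) x"
    using comm_group.free_Abelian_group_universal[OF N.M.a_comm_group im] by metis
  have "cyclic_evaluation S N P y0 b K h"
    unfolding cyclic_evaluation_def using y0 b(1) K KI h by auto
  then have "h (frag_of (n, y)) \<in> K" using b(2) by (intro G(3)) auto
  then have "b y \<odot>\<^bsub>N\<^esub> n \<in> K" using h(2)[of "(n, y)"] n y by simp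
  then obtain r m where "b y \<odot>\<^bsub>N\<^esub> n = r \<odot>\<^bsub>N\<^esub> m" "r \<in> carrier S" "m \<in> carrier N" "r \<odot>\<^bsub>P\<^esub> y0 = \<zero>\<^bsub>P\<^esub>"
    unfolding K_def by blast
  then show ?thesis using y0(1) b(1)[of y] b(2)[of y] by blast
qed

lemma tensor_kernel_diff:
  assumes "module S M" "module S P" "x \<in> tensor_kernel S M P" "y \<in> tensor_kernel S M P"
  shows "x - y \<in> tensor_kernel S M P"
  using tensor_kernel_add[OF assms(3) tensor_kernel_minus[OF assms(1,2,4)]] by simp

lemma tensor_kernel_balanced:
  assumes "a \<in> carrier S" "u \<in> carrier M" "y \<in> carrier P"
  shows "frag_of (a \<odot>\<^bsub>M\<^esub> u, y) - frag_of (u, a \<odot>\<^bsub>P\<^esub> y) \<in> tensor_kernel S M P"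
  by (rule tensor_kernel_relator) (use assms in \<open>auto simp: tensor_relators_def\<close>)

lemma tensor_kernel_subtract:
  assumes M: "module S M" and "u \<in> carrier M" "v \<in> carrier M" "y \<in> carrier P"
  shows "frag_of (u, y) - frag_of (u \<ominus>\<^bsub>M\<^esub> v, y) - frag_of (v, y) \<in> tensor_kernel S M P"
proof -
  interpret M: module S M by fact
  have "(u \<ominus>\<^bsub>M\<^esub> v) \<oplus>\<^bsub>M\<^esub> v = u" using assms by (simp add: a_minus_def M.M.a_assoc M.M.l_neg)
  moreover have "frag_of ((u \<ominus>\<^bsub>M\<^esub> v) \<oplus>\<^bsub>M\<^esub> v, y) - frag_of (u \<ominus>\<^bsub>M\<^esub> v, y) - frag_of (v, y) \<in> tensor_relators S M P"
    using assms M.M.minus_closed[of u v] unfolding tensor_relators_def by blast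
  ultimately show ?thesis using tensor_kernel_relator by metis
qed

lemma tensor_kernel_zero_left:
  assumes M: "module S M" and P: "module S P" and y: "y \<in> carrier P"
  shows "frag_of (\<zero>\<^bsub>M\<^esub>, y) \<in> tensor_kernel S M P"
proof -
  interpret M: module S M by fact
  have "frag_of (\<zero>\<^bsub>M\<^esub>, y) - frag_of (\<zero>\<^bsub>M\<^esub>, y) - frag_of (\<zero>\<^bsub>M\<^esub>, y) \<in> tensor_kernel S M P"
    using tensor_kernel_subtract[OF M _ _ y, of "\<zero>\<^bsub>M\<^esub>" "\<zero>\<^bsub>M\<^esub>"] M.M.r_neg[OF M.M.zero_closed] by (simp add: a_minus_def)
  from tensor_kernel_minus[OF M P this] show ?thesis by simp
qed

lemma tensor_kernel_zero_right:
  assumes M: "module S M" and P: "module S P" and u: "u \<in> carrier M"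
  shows "frag_of (u, \<zero>\<^bsub>P\<^esub>) \<in> tensor_kernel S M P"
proof -
  interpret M: module S M by fact
  interpret P: module S P by fact
  have "frag_of (\<zero>\<^bsub>S\<^esub> \<odot>\<^bsub>M\<^esub> u, \<zero>\<^bsub>P\<^esub>) - frag_of (u, \<zero>\<^bsub>S\<^esub> \<odot>\<^bsub>P\<^esub> \<zero>\<^bsub>P\<^esub>) \<in> tensor_kernel S M P"
    by (rule tensor_kernel_balanced) (use u in auto)
  then have "frag_of (\<zero>\<^bsub>M\<^esub>, \<zero>\<^bsub>P\<^esub>) - frag_of (u, \<zero>\<^bsub>P\<^esub>) \<in> tensor_kernel S M P" using u by simp
  from tensor_kernel_diff[OF M P tensor_kernel_zero_left[OF M P P.M.zero_closed] this] show ?thesis by simp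
qed

text \<open>
  In a difference of two pure tensors, whose second factors are y and a multiple \<open>c y\<close>, the scalar
  c can be moved to the first factor, after which the second factors agree.
\<close>

lemma every_tensor_pure:
  assumes M: "module S M" and P: "module S P" and uni: "uniserial S P"
    and x: "Poly_Mapping.keys x \<subseteq> carrier M \<times> carrier P"
  shows "\<exists>u\<in>carrier M. \<exists>y\<in>carrier P. x - frag_of (u, y) \<in> tensor_kernel S M P"
proof -
  interpret M: module S M by fact
  interpret P: module S P by fact
  let ?K = "tensor_kernel S M P"
  show ?thesis
    using x
  proof (induction x rule: frag_induction)
    case zero
    have "0 - frag_of (\<zero>\<^bsub>M\<^esub>, \<zero>\<^bsub>P\<^esub>) \<in> ?K"
      by (rule tensor_kernel_diff[OF M P tensor_kernel_zero tensor_kernel_zero_left[OF M P]]) simp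
    then show ?case by (intro bexI) auto
  next
    case (one x)
    then have "fst x \<in> carrier M" "snd x \<in> carrier P" by auto
    moreover have "frag_of x - frag_of (fst x, snd x) \<in> ?K" by (simp add: tensor_kernel_zero)
    ultimately show ?case by blast
  next
    case (diff a b)
    have shared: "\<exists>w\<in>carrier M. \<exists>z\<in>carrier P. a - b - frag_of (w, z) \<in> ?K"
      if "u \<in> carrier M" "v \<in> carrier M" "y \<in> carrier P"
        "a - frag_of (u, y) \<in> ?K" "b - frag_of (v, y) \<in> ?K" for u v y
    proof -
      have "(a - frag_of (u, y)) - (b - frag_of (v, y)) +
          (frag_of (u, y) - frag_of (u \<ominus>\<^bsub>M\<^esub> v, y) - frag_of (v, y)) \<in> ?K"
        by (rule tensor_kernel_add[OF tensor_kernel_diff[OF M P that(4,5)] tensor_kernel_subtract[OF M that(1-3)]])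
      then have "a - b - frag_of (u \<ominus>\<^bsub>M\<^esub> v, y) \<in> ?K" by (simp add: algebra_simps)
      then show ?thesis using that(1-3) by blast
    qed
    have slide: "a - frag_of (c \<odot>\<^bsub>M\<^esub> u, y) \<in> ?K"
      if "a - frag_of (u, c \<odot>\<^bsub>P\<^esub> y) \<in> ?K" "c \<in> carrier S" "u \<in> carrier M" "y \<in> carrier P" for a c u y
      using tensor_kernel_diff[OF M P that(1) tensor_kernel_balanced[OF that(2-4)]] by simp
    obtain u y where u: "u \<in> carrier M" "y \<in> carrier P" "a - frag_of (u, y) \<in> ?K" using diff by blast
    obtain v z where v: "v \<in> carrier M" "z \<in> carrier P" "b - frag_of (v, z) \<in> ?K" using diff by blast
    from uni u(2) v(2) consider c where "c \<in> carrier S" "y = c \<odot>\<^bsub>P\<^esub> z" | c where "c \<in> carrier S" "z = c \<odot>\<^bsub>P\<^esub> y"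
      unfolding uniserial_def by blast
    then show ?case
    proof cases
      case (1 c)
      then show ?thesis using shared[of "c \<odot>\<^bsub>M\<^esub> u" v z] slide[of a u c z] u v by simp
    next
      case (2 c)
      then show ?thesis using shared[of u "c \<odot>\<^bsub>M\<^esub> v" y] slide[of b v c y] u v by simp
    qed
  qed
qed

text \<open>
  For the direct implication, tensor the inclusion of \<open>rS\<close> into S with P: the tensor \<open>r \<otimes> x\<close>
  becomes \<open>1 \<otimes> r x = 0\<close> in \<open>S \<otimes> P\<close>, so it is zero in \<open>rS \<otimes> P\<close>, and
  \<open>pure_tensor_vanishes\<close> says what this means. Conversely, if f is injective and
  \<open>f(u) \<otimes> y = 0\<close>, then \<open>y = b y0\<close> and \<open>b f(u) = r n\<close> with \<open>r y0 = 0\<close>. Factoring \<open>y0 = s y1\<close> with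
  \<open>r s = 0\<close> gives \<open>f(s b u) = 0\<close>, hence \<open>s b u = 0\<close> and \<open>u \<otimes> y = s b u \<otimes> y1 = 0\<close>.
\<close>

lemma flat_uniserial_iff:
  assumes S: "chain_ring S" and P: "module S P" and uni: "uniserial S P"
  shows "flat_module S P \<longleftrightarrow> (\<forall>r\<in>carrier S. \<forall>x\<in>carrier P. r \<odot>\<^bsub>P\<^esub> x = \<zero>\<^bsub>P\<^esub> \<longrightarrow>
    (\<exists>s\<in>carrier S. \<exists>y\<in>carrier P. x = s \<odot>\<^bsub>P\<^esub> y \<and> r \<otimes>\<^bsub>S\<^esub> s = \<zero>\<^bsub>S\<^esub>))" (is "_ \<longleftrightarrow> ?C")
proof
  interpret S: chain_ring S by fact
  interpret P: module S P by fact
  assume flat: "flat_module S P"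
  show ?C
  proof (intro ballI impI)
    fix r x assume r: "r \<in> carrier S" and x: "x \<in> carrier P" and rx: "r \<odot>\<^bsub>P\<^esub> x = \<zero>\<^bsub>P\<^esub>"
    let ?M = "ideal_module S (PIdl\<^bsub>S\<^esub> r)" and ?N = "ideal_module S (carrier S)"
    have M: "module S ?M" by (rule module_ideal_module[OF S.is_cring S.cgenideal_ideal[OF r]])
    have N: "module S ?N" by (rule module_ideal_module[OF S.is_cring S.oneideal])
    have sub: "PIdl\<^bsub>S\<^esub> r \<subseteq> carrier S" using r by (auto simp: cgenideal_def)
    have id: "id \<in> linear_maps S ?M ?N" using sub by (auto simp: linear_maps_def ideal_module_def)
    have rM: "r \<in> carrier ?M" using S.cgenideal_self[OF r] by (simp add: ideal_module_def)
    have "frag_of (r \<odot>\<^bsub>?N\<^esub> \<one>\<^bsub>S\<^esub>, x) - frag_of (\<one>\<^bsub>S\<^esub>, r \<odot>\<^bsub>P\<^esub> x) \<in> tensor_kernel S ?N P"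
      by (rule tensor_kernel_balanced) (use r x in \<open>auto simp: ideal_module_def\<close>)
    then have "frag_of (r, x) - frag_of (\<one>\<^bsub>S\<^esub>, \<zero>\<^bsub>P\<^esub>) \<in> tensor_kernel S ?N P"
      using r rx by (simp add: ideal_module_def)
    moreover have "frag_of (\<one>\<^bsub>S\<^esub>, \<zero>\<^bsub>P\<^esub>) \<in> tensor_kernel S ?N P"
      by (rule tensor_kernel_zero_right[OF N P]) (simp add: ideal_module_def)
    ultimately have "frag_of (r, x) \<in> tensor_kernel S ?N P"
      using tensor_kernel_add by fastforce
    then have "frag_of (r, x) \<in> tensor_kernel S ?M P"
      using flat_moduleD[OF flat id M N] inj_tensor_map_iff[OF id M N P] rM x
      by (auto simp: map_first_id keys_frag_of)
    then obtain y b t n where y: "y \<in> carrier P" "b \<in> carrier S" "t \<in> carrier S" "n \<in> carrier ?M"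
        "x = b \<odot>\<^bsub>P\<^esub> y" "t \<odot>\<^bsub>P\<^esub> y = \<zero>\<^bsub>P\<^esub>" "b \<odot>\<^bsub>?M\<^esub> r = t \<odot>\<^bsub>?M\<^esub> n"
      using pure_tensor_vanishes[OF S M P uni rM x] by blast
    obtain c where c: "c \<in> carrier S" "n = c \<otimes>\<^bsub>S\<^esub> r" using y(4) by (auto simp: ideal_module_def cgenideal_def)
    \<comment> \<open>now \<open>b r = t c r\<close>, and subtracting \<open>c t\<close> from b changes nothing on y\<close>
    let ?s = "b \<ominus>\<^bsub>S\<^esub> c \<otimes>\<^bsub>S\<^esub> t"
    have "?s \<odot>\<^bsub>P\<^esub> y = b \<odot>\<^bsub>P\<^esub> y \<ominus>\<^bsub>P\<^esub> c \<odot>\<^bsub>P\<^esub> (t \<odot>\<^bsub>P\<^esub> y)"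
      using y(1-3) c by (simp add: a_minus_def a_minus_def P.smult_l_distr P.smult_l_minus P.smult_assoc1)
    then have "x = ?s \<odot>\<^bsub>P\<^esub> y" using y c by (simp add: a_minus_def)
    moreover have "r \<otimes>\<^bsub>S\<^esub> ?s = b \<otimes>\<^bsub>S\<^esub> r \<ominus>\<^bsub>S\<^esub> t \<otimes>\<^bsub>S\<^esub> (c \<otimes>\<^bsub>S\<^esub> r)"
      using y(2,3) c r by (simp add: a_minus_def S.r_distr S.r_minus S.m_ac)
    then have "r \<otimes>\<^bsub>S\<^esub> ?s = \<zero>\<^bsub>S\<^esub>" using y(2,3,7) c r by (simp add: ideal_module_def a_minus_def S.r_neg)
    ultimately show "\<exists>s\<in>carrier S. \<exists>y\<in>carrier P. x = s \<odot>\<^bsub>P\<^esub> y \<and> r \<otimes>\<^bsub>S\<^esub> s = \<zero>\<^bsub>S\<^esub>"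
      using y(1-3) c by (intro bexI[of _ ?s] bexI[of _ y]) auto
  qed
next
  interpret S: chain_ring S by fact
  interpret P: module S P by fact
  assume C: ?C
  show "flat_module S P"
    unfolding flat_module_def
  proof (intro conjI P allI ballI impI, elim conjE)
    fix M N :: "('a, (nat \<Rightarrow> 'a) set) module" and f
    assume f: "f \<in> linear_maps S M N" and M: "module S M" and N: "module S N" and inj: "inj_on f (carrier M)"
    interpret M: module S M by fact
    interpret N: module S N by fact
    have fc: "f x \<in> carrier N" if "x \<in> carrier M" for x using f that by (auto simp: linear_maps_def)
    have fs: "f (a \<odot>\<^bsub>M\<^esub> x) = a \<odot>\<^bsub>N\<^esub> f x" if "a \<in> carrier S" "x \<in> carrier M" for a x
      using f that by (auto simp: linear_maps_def)
    have f0: "f \<zero>\<^bsub>M\<^esub> = \<zero>\<^bsub>N\<^esub>" using fs[of "\<zero>\<^bsub>S\<^esub>" "\<zero>\<^bsub>M\<^esub>"] fc[of "\<zero>\<^bsub>M\<^esub>"] by simp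
    show "inj_on (tensor_map S N P f) (carrier (tensor_product S M P))"
      unfolding inj_tensor_map_iff[OF f M N P]
    proof (intro allI impI)
      fix x assume x: "Poly_Mapping.keys x \<subseteq> carrier M \<times> carrier P" and fx: "map_first f x \<in> tensor_kernel S N P"
      obtain u y where u: "u \<in> carrier M" and y: "y \<in> carrier P" and xu: "x - frag_of (u, y) \<in> tensor_kernel S M P"
        using every_tensor_pure[OF M P uni x] by blast
      have "map_first f x - map_first f (x - frag_of (u, y)) \<in> tensor_kernel S N P"
        by (rule tensor_kernel_diff[OF N P fx map_first_kernel[OF f M N P xu]])
      then have "frag_of (f u, y) \<in> tensor_kernel S N P" by (simp add: map_first_def frag_extend_diff)
      then obtain y0 b r n where 0: "y0 \<in> carrier P" "b \<in> carrier S" "r \<in> carrier S" "n \<in> carrier N"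
          "y = b \<odot>\<^bsub>P\<^esub> y0" "r \<odot>\<^bsub>P\<^esub> y0 = \<zero>\<^bsub>P\<^esub>" "b \<odot>\<^bsub>N\<^esub> f u = r \<odot>\<^bsub>N\<^esub> n"
        using pure_tensor_vanishes[OF S N P uni fc[OF u] y] by blast
      obtain s y1 where 1: "s \<in> carrier S" "y1 \<in> carrier P" "y0 = s \<odot>\<^bsub>P\<^esub> y1" "r \<otimes>\<^bsub>S\<^esub> s = \<zero>\<^bsub>S\<^esub>"
        using C 0(1,3,6) by blast
      have "f ((s \<otimes>\<^bsub>S\<^esub> b) \<odot>\<^bsub>M\<^esub> u) = s \<odot>\<^bsub>N\<^esub> (b \<odot>\<^bsub>N\<^esub> f u)"
        using 0(2) 1(1) u fc by (simp add: fs N.smult_assoc1)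
      also have "\<dots> = (r \<otimes>\<^bsub>S\<^esub> s) \<odot>\<^bsub>N\<^esub> n"
        using 0(3,4) 1(1) by (simp add: 0(7) N.smult_assoc1[symmetric] S.m_comm)
      also have "\<dots> = f \<zero>\<^bsub>M\<^esub>" using 1 0 f0 by simp
      finally have z: "(s \<otimes>\<^bsub>S\<^esub> b) \<odot>\<^bsub>M\<^esub> u = \<zero>\<^bsub>M\<^esub>"
        using inj_onD[OF inj] 0(2) 1(1) u by simp
      have yy: "y = (s \<otimes>\<^bsub>S\<^esub> b) \<odot>\<^bsub>P\<^esub> y1" using 0(2,5) 1(1-3) by (simp add: P.smult_assoc1 S.m_comm[of s])
      have "frag_of ((s \<otimes>\<^bsub>S\<^esub> b) \<odot>\<^bsub>M\<^esub> u, y1) - frag_of (u, (s \<otimes>\<^bsub>S\<^esub> b) \<odot>\<^bsub>P\<^esub> y1) \<in> tensor_kernel S M P"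
        by (rule tensor_kernel_balanced) (use 0 1 u in auto)
      then have d: "frag_of (\<zero>\<^bsub>M\<^esub>, y1) - frag_of (u, y) \<in> tensor_kernel S M P" by (simp only: z yy)
      have "(x - frag_of (u, y)) - ((frag_of (\<zero>\<^bsub>M\<^esub>, y1) - frag_of (u, y)) - frag_of (\<zero>\<^bsub>M\<^esub>, y1)) \<in> tensor_kernel S M P"
        by (rule tensor_kernel_diff[OF M P xu tensor_kernel_diff[OF M P d tensor_kernel_zero_left[OF M P 1(2)]]])
      then show "x \<in> tensor_kernel S M P" by simp
    qed
  qed
qed


section \<open>Ideals as modules modulo their annihilators\<close>

context chain_ring
begin

text \<open>
  The relations \<open>r x = 0\<close> in I all come from relations \<open>r s = 0\<close> in \<open>R/(0:I)\<close>, written out in R.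
\<close>

definition flat_criterion :: "'a set \<Rightarrow> bool" where
  "flat_criterion I \<longleftrightarrow> (\<forall>r\<in>carrier R. \<forall>x\<in>I. r \<otimes> x = \<zero> \<longrightarrow>
     (\<exists>s\<in>carrier R. \<exists>y\<in>I. x = s \<otimes> y \<and> (\<forall>w\<in>I. r \<otimes> s \<otimes> w = \<zero>)))"

lemma flat_over_quotient_iff:
  assumes I: "ideal I R"
  shows "flat_module (R Quot (annihilator R I)) (over_quotient (ideal_module R I)) \<longleftrightarrow> flat_criterion I"
proof -
  interpret I: ideal I R by fact
  let ?A = "annihilator R I"
  let ?S = "R Quot ?A" and ?P = "over_quotient (ideal_module R I)"
  interpret A: ideal ?A R by (rule module_over_quotient(1)[OF is_cring I])
  have P: "module ?S ?P" by (rule module_over_quotient(2)[OF is_cring I])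
  have smult: "(?A +> r) \<odot>\<^bsub>?P\<^esub> x = r \<otimes> x" if r: "r \<in> carrier R" and x: "x \<in> I" for r x
  proof -
    have "y \<otimes> x = r \<otimes> x" if y: "y \<in> ?A +> r" for y
    proof -
      obtain h where h: "h \<in> ?A" "y = h \<oplus> r" using y unfolding a_r_coset_def' by blast
      have "h \<in> carrier R" "h \<otimes> x = \<zero>" using h(1) x unfolding annihilator_def by blast+
      then show ?thesis using r I.Icarr[OF x] by (simp add: h(2) l_distr)
    qed
    then have "(\<lambda>r. r \<otimes> x) ` (?A +> r) = {r \<otimes> x}" using A.a_rcos_self[OF r] by blast
    then show ?thesis by (simp add: over_quotient_def ideal_module_def)
  qed
  have carS: "carrier ?S = (\<lambda>r. ?A +> r) ` carrier R" by (auto simp: FactRing_simps)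
  have mult: "(?A +> r) \<otimes>\<^bsub>?S\<^esub> (?A +> s) = ?A +> (r \<otimes> s)" if "r \<in> carrier R" "s \<in> carrier R" for r s
    using that by (simp add: FactRing_simps A.rcoset_mult_add)
  have zero: "?A +> t = \<zero>\<^bsub>?S\<^esub> \<longleftrightarrow> (\<forall>w\<in>I. t \<otimes> w = \<zero>)" if t: "t \<in> carrier R" for t
  proof -
    have "?A +> t = ?A \<longleftrightarrow> t \<in> ?A"
      using A.a_rcos_self[OF t] A.a_rcos_const[of t] by auto
    moreover have "t \<in> ?A \<longleftrightarrow> (\<forall>w\<in>I. t \<otimes> w = \<zero>)" using t unfolding annihilator_def by blast
    moreover have "\<zero>\<^bsub>?S\<^esub> = ?A" by (simp add: FactRing_def)
    ultimately show ?thesis by metis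
  qed
  have carP: "carrier ?P = I" and zeroP: "\<zero>\<^bsub>?P\<^esub> = \<zero>" by (simp_all add: over_quotient_def ideal_module_def)
  have S: "chain_ring ?S"
  proof (rule chain_ringI[OF A.quotient_is_cring[OF is_cring]])
    fix a b assume "a \<in> carrier ?S" "b \<in> carrier ?S"
    then obtain r s where rs: "r \<in> carrier R" "s \<in> carrier R" "a = ?A +> r" "b = ?A +> s" by (auto simp: carS)
    from rs(1,2) show "(\<exists>c\<in>carrier ?S. a = c \<otimes>\<^bsub>?S\<^esub> b) \<or> (\<exists>c\<in>carrier ?S. b = c \<otimes>\<^bsub>?S\<^esub> a)"
    proof (cases rule: divides_total)
      case (1 c)
      then have "a = (?A +> c) \<otimes>\<^bsub>?S\<^esub> b" using rs by (simp add: mult)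
      then show ?thesis using 1 by (auto simp: carS)
    next
      case (2 c)
      then have "b = (?A +> c) \<otimes>\<^bsub>?S\<^esub> a" using rs by (simp add: mult)
      then show ?thesis using 2 by (auto simp: carS)
    qed
  qed
  have uni: "uniserial ?S ?P"
    unfolding uniserial_def carP
  proof (intro ballI)
    fix x y assume xy: "x \<in> I" "y \<in> I"
    then have "x \<in> carrier R" "y \<in> carrier R" using I.Icarr by auto
    then show "(\<exists>a\<in>carrier ?S. x = a \<odot>\<^bsub>?P\<^esub> y) \<or> (\<exists>a\<in>carrier ?S. y = a \<odot>\<^bsub>?P\<^esub> x)"
    proof (cases rule: divides_total)
      case (1 c)
      then show ?thesis using xy by (auto simp: carS smult)
    next
      case (2 c)
      then show ?thesis using xy by (auto simp: carS smult)
    qed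
  qed
  show ?thesis
    unfolding flat_uniserial_iff[OF S P uni] flat_criterion_def
    by (simp add: carS carP zeroP smult mult zero cong: ball_cong bex_cong)
qed


section \<open>Comparison of zerodivisors with nilpotent elements\<close>

text \<open>
  The nilradical itself is the ideal that fails the criterion when some zerodivisor is not
  nilpotent.
\<close>

lemma zerodivisors_subset_nilradical:
  assumes "flat_criterion (nilradical R)"
  shows "zerodivisors R \<subseteq> nilradical R"
proof (rule subsetI, rule ccontr)
  fix z assume z: "z \<in> zerodivisors R" "z \<notin> nilradical R"
  have zR: "z \<in> carrier R" using z by (simp add: zerodivisors_def)
  interpret N: ideal "nilradical R" R by (rule ideal_nilradical)
  have "z \<noteq> \<zero>" using z N.zero_closed by auto
  then obtain x where x: "x \<in> carrier R" "x \<noteq> \<zero>" "z \<otimes> x = \<zero>" using z zerodivisorsE by blast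
  have "x \<in> nilradical R" using nilradical_prime[OF zR x(1)] x(3) z N.zero_closed by auto
  then obtain s y where s: "s \<in> carrier R" "y \<in> nilradical R" "x = s \<otimes> y"
      "\<forall>w\<in>nilradical R. z \<otimes> s \<otimes> w = \<zero>"
    using assms zR x(3) unfolding flat_criterion_def by blast
  have yR: "y \<in> carrier R" using s N.Icarr by auto
  show False
    using yR zR
  proof (cases rule: divides_total)
    case (1 c)
    then have "c \<in> nilradical R" using nilradical_prime[of c z] zR s(2) z(2) by auto
    then have "z \<otimes> s \<otimes> c = \<zero>" using s(4) by blast
    moreover have "x = z \<otimes> s \<otimes> c" using s(1,3) 1 zR by (simp add: m_ac)
    ultimately show False using x by simp
  next
    case (2 c)
    then show False using N.I_l_closed s(2) z(2) by auto
  qed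
qed

text \<open>
  An approximate Nakayama lemma: if every element of I were in \<open>T I\<close>, a nonzero x could be
  factored through T arbitrarily often, making a nonzero multiple of x divisible by every power
  of the nilpotent element p. Regular multipliers are allowed because the members of T need to be multiples of p only
  after passing to the quotient ring.
\<close>

lemma exists_not_nilpotent_multiple:
  assumes I: "ideal I R" and x: "x \<in> I" "x \<noteq> \<zero>" and p: "p \<in> nilradical R"
    and T: "\<And>t. t \<in> T \<Longrightarrow> t \<in> carrier R \<and>
      (\<exists>c\<in>carrier R - zerodivisors R. \<exists>e\<in>carrier R. c \<otimes> t = p \<otimes> e)"
  shows "\<exists>y\<in>I. \<forall>t\<in>T. \<forall>w\<in>I. y \<noteq> t \<otimes> w"
proof (rule ccontr)
  assume "\<not> ?thesis"
  then have H: "\<exists>t\<in>T. \<exists>w\<in>I. y = t \<otimes> w" if "y \<in> I" for y using that by blast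
  interpret I: ideal I R by fact
  have xR: "x \<in> carrier R" using x I.Icarr by auto
  have one: "\<one> \<noteq> \<zero>" using x xR by (metis l_null l_one)
  have pR: "p \<in> carrier R" using p by (simp add: nilradical_def)
  obtain n :: nat where n: "p [^] n = \<zero>" using p by (auto simp: nilradical_def)
  have "\<exists>c\<in>carrier R - zerodivisors R. \<exists>w\<in>I. c \<otimes> x = p [^] m \<otimes> w" for m :: nat
  proof (induction m)
    case 0
    show ?case using regular_one[OF one] x xR by (intro bexI[of _ \<one>] bexI[of _ x]) auto
  next
    case (Suc m)
    then obtain c w where c: "c \<in> carrier R - zerodivisors R" "w \<in> I" "c \<otimes> x = p [^] m \<otimes> w" by auto
    obtain t v where t: "t \<in> T" "v \<in> I" "w = t \<otimes> v" using H c by blast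
    obtain d e where d: "t \<in> carrier R" "d \<in> carrier R - zerodivisors R" "e \<in> carrier R" "d \<otimes> t = p \<otimes> e"
      using T[OF t(1)] by auto
    note car = c(1) d(1,2,3) pR xR I.Icarr[OF t(2)]
    have "(d \<otimes> c) \<otimes> x = d \<otimes> (c \<otimes> x)" using car by (simp add: m_assoc)
    also have "\<dots> = p [^] m \<otimes> (d \<otimes> t) \<otimes> v" using car t(3) c(3) by (simp add: m_ac)
    also have "\<dots> = p [^] Suc m \<otimes> (e \<otimes> v)" using car by (simp add: d(4) m_ac)
    finally show ?case using regular_mult[OF d(2) c(1)] I.I_l_closed[OF t(2) d(3)] by blast
  qed
  then obtain c w where c: "c \<in> carrier R - zerodivisors R" and w: "w \<in> I" and "c \<otimes> x = p [^] n \<otimes> w" by blast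
  then have "c \<otimes> x = \<zero>" using n I.Icarr[OF w] by simp
  then show False using regular_cancel[OF c xR] x(2) by simp
qed

text \<open>
  An element p of Z outside \<open>Z\<^sup>2\<close> generates Z in the quotient ring: if \<open>p = c t\<close> with t in Z, then
  c is regular. Likewise an element y of I outside \<open>Z I\<close> generates I in the quotient ring, so
  whatever kills y kills I.
\<close>

lemma flat_criterion_if_zerodivisors_not_idempotent:
  assumes ZN: "zerodivisors R = nilradical R"
    and ne: "zerodivisors R \<noteq> ideal_prod R (zerodivisors R) (zerodivisors R)" and I: "ideal I R"
  shows "flat_criterion I"
  unfolding flat_criterion_def
proof (intro ballI impI)
  let ?Z = "zerodivisors R"
  fix r x assume r: "r \<in> carrier R" and x: "x \<in> I" and rx: "r \<otimes> x = \<zero>"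
  interpret I: ideal I R by fact
  interpret Z: ideal ?Z R unfolding ZN by (rule ideal_nilradical)
  have xR: "x \<in> carrier R" using x I.Icarr by auto
  show "\<exists>s\<in>carrier R. \<exists>y\<in>I. x = s \<otimes> y \<and> (\<forall>w\<in>I. r \<otimes> s \<otimes> w = \<zero>)"
  proof (cases "x = \<zero>")
    case True
    then show ?thesis using x r I.Icarr by (intro bexI[of _ \<zero>] bexI[of _ x]) auto
  next
    case False
    then have one: "\<one> \<noteq> \<zero>" using xR by (metis l_null l_one)
    have "ideal_prod R ?Z ?Z \<subseteq> ?Z"
      using ideal_prod_inter[OF Z.ideal_axioms Z.ideal_axioms] by auto
    then obtain p where p: "p \<in> ?Z" "p \<notin> ideal_prod R ?Z ?Z" using ne by auto
    have pR: "p \<in> carrier R" using p Z.Icarr by auto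
    have T: "t \<in> carrier R \<and> (\<exists>c\<in>carrier R - ?Z. \<exists>e\<in>carrier R. c \<otimes> t = p \<otimes> e)" if t: "t \<in> ?Z" for t
    proof -
      have tR: "t \<in> carrier R" using t Z.Icarr by auto
      from tR pR show ?thesis
      proof (cases rule: divides_total)
        case (1 c)
        then have "\<one> \<otimes> t = p \<otimes> c" using pR tR by (simp add: m_comm)
        then show ?thesis using 1 tR regular_one[OF one] by blast
      next
        case (2 c)
        then have "c \<notin> ?Z" using p(2) t ideal_prod.prod[of c ?Z t ?Z R] by auto
        then show ?thesis using 2 tR pR by (intro conjI bexI[of _ c] bexI[of _ \<one>]) auto
      qed
    qed
    obtain y where y: "y \<in> I" "\<And>t w. t \<in> ?Z \<Longrightarrow> w \<in> I \<Longrightarrow> y \<noteq> t \<otimes> w"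
      using exists_not_nilpotent_multiple[OF I x False, of p ?Z] p(1) ZN T by blast
    have yR: "y \<in> carrier R" using y I.Icarr by auto
    have top: "v \<otimes> w = \<zero>" if v: "v \<in> carrier R" "v \<otimes> y = \<zero>" and w: "w \<in> I" for v w
    proof -
      have wR: "w \<in> carrier R" using w I.Icarr by auto
      from wR yR show ?thesis
      proof (cases rule: divides_total)
        case (1 c)
        then have "v \<otimes> w = c \<otimes> (v \<otimes> y)" using v yR by (simp add: m_ac)
        then show ?thesis using v 1 by simp
      next
        case (2 c)
        then have "c \<in> carrier R - ?Z" using y(2) w by auto
        moreover have "c \<otimes> (v \<otimes> w) = \<zero>" using 2 v wR by (simp add: m_ac)
        ultimately show ?thesis using regular_cancel v wR by auto
      qed
    qed
    show ?thesis
      using xR yR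
    proof (cases rule: divides_total)
      case (1 s)
      then have "r \<otimes> s \<otimes> y = \<zero>" using rx r yR by (simp add: m_assoc)
      then show ?thesis using top[of "r \<otimes> s"] 1 r y(1) by (intro bexI[of _ s] bexI[of _ y]) auto
    next
      case (2 a)
      then have "r \<otimes> y = a \<otimes> (r \<otimes> x)" using r xR by (simp add: m_ac)
      then have "r \<otimes> y = \<zero>" using rx 2 by simp
      then have "\<forall>w\<in>I. r \<otimes> \<one> \<otimes> w = \<zero>" using top[of r] r by auto
      then show ?thesis using x xR by (intro bexI[of _ \<one>] bexI[of _ x]) auto
    qed
  qed
qed

text \<open>
  The task is to find s with x in \<open>s I\<close> and \<open>s I \<subseteq> (0:r)\<close>. Some y in I satisfies \<open>q I \<subseteq> R y\<close>. If
  \<open>x' = a y\<close>, then \<open>s = q a\<close> works; if \<open>y = a x'\<close>, then \<open>s = q\<close> works: in both cases \<open>s I\<close> is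
  contained in \<open>R x'\<close>, hence in \<open>(0:r)\<close>, and contains \<open>x = q x'\<close>. In terms of values, the room
  between the threshold of \<open>(0:r)\<close> and x makes up for the missing generator of the ideal.
\<close>

lemma flat_criterion_if_nilpotently_divisible:
  assumes I: "ideal I R"
    and div: "\<And>r x. \<lbrakk>r \<in> carrier R; r \<noteq> \<zero>; x \<in> carrier R; x \<noteq> \<zero>; r \<otimes> x = \<zero>\<rbrakk> \<Longrightarrow>
      \<exists>q\<in>nilradical R. \<exists>x'\<in>carrier R. r \<otimes> x' = \<zero> \<and> x = q \<otimes> x'"
  shows "flat_criterion I"
  unfolding flat_criterion_def
proof (intro ballI impI)
  fix r x assume r: "r \<in> carrier R" and x: "x \<in> I" and rx: "r \<otimes> x = \<zero>"
  interpret I: ideal I R by fact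
  have xR: "x \<in> carrier R" using x I.Icarr by auto
  show "\<exists>s\<in>carrier R. \<exists>y\<in>I. x = s \<otimes> y \<and> (\<forall>w\<in>I. r \<otimes> s \<otimes> w = \<zero>)"
  proof (cases "x = \<zero> \<or> (\<forall>w\<in>I. r \<otimes> w = \<zero>)")
    case True
    then show ?thesis
    proof
      assume "x = \<zero>"
      then show ?thesis using x r I.Icarr by (intro bexI[of _ \<zero>] bexI[of _ x]) auto
    next
      assume "\<forall>w\<in>I. r \<otimes> w = \<zero>"
      then show ?thesis using x xR r by (intro bexI[of _ \<one>] bexI[of _ x]) auto
    qed
  next
    case False
    then obtain z where z: "z \<in> I" "r \<otimes> z \<noteq> \<zero>" and x0: "x \<noteq> \<zero>" by auto
    have zR: "z \<in> carrier R" using z I.Icarr by auto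
    have "r \<noteq> \<zero>" using z zR by auto
    then obtain q x' where q: "q \<in> nilradical R" and x': "x' \<in> carrier R" "r \<otimes> x' = \<zero>" "x = q \<otimes> x'"
      using div[OF r _ xR x0 rx] by blast
    have qR: "q \<in> carrier R" using q by (simp add: nilradical_def)
    \<comment> \<open>z is not in \<open>(0:r)\<close>, so this ideal, and in particular \<open>x'\<close>, lies in \<open>R z\<close>\<close>
    have x'I: "x' \<in> I"
      using x'(1) zR
    proof (cases rule: divides_total)
      case (1 c)
      then show ?thesis using I.I_l_closed z by auto
    next
      case (2 c)
      then have "r \<otimes> z = c \<otimes> (r \<otimes> x')" using r x' by (simp add: m_ac)
      then show ?thesis using z x' 2 by simp
    qed
    have one: "\<one> \<noteq> \<zero>" using x0 xR by (metis l_null l_one)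
    have T: "t \<in> carrier R \<and> (\<exists>c\<in>carrier R - zerodivisors R. \<exists>e\<in>carrier R. c \<otimes> t = q \<otimes> e)"
      if t: "t \<in> (\<lambda>c. c \<otimes> q) ` carrier R" for t
    proof -
      obtain c where c: "c \<in> carrier R" "t = c \<otimes> q" using t by auto
      then have "\<one> \<otimes> t = q \<otimes> c" using qR by (simp add: m_comm)
      then show ?thesis using c qR regular_one[OF one] by blast
    qed
    have "\<exists>y\<in>I. \<forall>t\<in>(\<lambda>c. c \<otimes> q) ` carrier R. \<forall>w\<in>I. y \<noteq> t \<otimes> w"
      by (rule exists_not_nilpotent_multiple[OF I x x0 q]) (rule T)
    then obtain y where y: "y \<in> I" and "\<forall>t\<in>(\<lambda>c. c \<otimes> q) ` carrier R. \<forall>w\<in>I. y \<noteq> t \<otimes> w"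
      by (elim bexE)
    then have y': "y \<noteq> c \<otimes> q \<otimes> w" if "c \<in> carrier R" "w \<in> I" for c w
      using that by simp
    have yR: "y \<in> carrier R" using y I.Icarr by auto
    have top: "\<exists>c\<in>carrier R. q \<otimes> w = c \<otimes> y" if w: "w \<in> I" for w
    proof -
      have wR: "w \<in> carrier R" using w I.Icarr by auto
      have "q \<otimes> w \<in> carrier R" using qR wR by simp
      from this yR show ?thesis
      proof (cases rule: divides_total)
        case (1 c)
        then show ?thesis by blast
      next
        case (2 c)
        then have "y = c \<otimes> q \<otimes> w" using qR wR by (simp add: m_assoc)
        then show ?thesis using y'[OF 2(1) w] by simp
      qed
    qed
    show ?thesis
      using x'(1) yR
    proof (cases rule: divides_total)
      case (1 a)
      have "r \<otimes> (q \<otimes> a) \<otimes> w = \<zero>" if w: "w \<in> I" for w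
      proof -
        obtain c where c: "c \<in> carrier R" "q \<otimes> w = c \<otimes> y" using top[OF w] by auto
        have "r \<otimes> (q \<otimes> a) \<otimes> w = r \<otimes> a \<otimes> (q \<otimes> w)" using r qR 1 I.Icarr[OF w] by (simp add: m_ac)
        also have "\<dots> = c \<otimes> (r \<otimes> (a \<otimes> y))" using c 1(1) r yR by (simp add: m_ac)
        also have "\<dots> = \<zero>" using c x' 1 by simp
        finally show ?thesis .
      qed
      moreover have "x = q \<otimes> a \<otimes> y" using 1 x' qR yR by (simp add: m_assoc)
      ultimately show ?thesis using 1(1) qR y by (intro bexI[of _ "q \<otimes> a"] bexI[of _ y]) auto
    next
      case (2 a)
      have "r \<otimes> q \<otimes> w = \<zero>" if w: "w \<in> I" for w
      proof -
        obtain c where c: "c \<in> carrier R" "q \<otimes> w = c \<otimes> y" using top[OF w] by auto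
        have "r \<otimes> q \<otimes> w = r \<otimes> (q \<otimes> w)" using r qR I.Icarr[OF w] by (simp add: m_assoc)
        also have "\<dots> = c \<otimes> a \<otimes> (r \<otimes> x')" using c 2 r x'(1) by (simp add: m_ac)
        also have "\<dots> = \<zero>" using c x' 2 by simp
        finally show ?thesis .
      qed
      then show ?thesis using qR x'I x'(3) by (intro bexI[of _ q] bexI[of _ x']) auto
    qed
  qed
qed


section \<open>Coherence of the quotient ring\<close>

text \<open>
  If \<open>a c \<noteq> 0\<close>, then everything killed by a is a multiple of c, so \<open>(0:a) = c (0:a c)\<close>. As any two
  elements r and a are comparable, a generator of \<open>(0:r)\<close> can be carried over to \<open>(0:a)\<close> in either
  direction; here generators are meant up to regular multipliers, as in the quotient ring.
\<close>

lemma annihilators_principal_up_to_regular: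
  assumes r: "r \<in> carrier R" and x: "x \<in> carrier R" "x \<noteq> \<zero>" and rx: "r \<otimes> x = \<zero>" and r0: "r \<noteq> \<zero>"
    and gen: "\<And>y. y \<in> carrier R \<Longrightarrow> r \<otimes> y = \<zero> \<Longrightarrow>
      \<exists>c\<in>carrier R - zerodivisors R. \<exists>e\<in>carrier R. c \<otimes> y = x \<otimes> e"
    and a: "a \<in> carrier R"
  shows "\<exists>d\<in>carrier R. a \<otimes> d = \<zero> \<and> (\<forall>y\<in>carrier R. a \<otimes> y = \<zero> \<longrightarrow>
      (\<exists>c\<in>carrier R - zerodivisors R. \<exists>e\<in>carrier R. c \<otimes> y = d \<otimes> e))"
proof -
  have one: "\<one> \<in> carrier R - zerodivisors R" using x by (intro regular_one) (metis l_null l_one)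
  show ?thesis
  proof (cases "a = \<zero>")
    case True
    have "\<exists>c\<in>carrier R - zerodivisors R. \<exists>e\<in>carrier R. c \<otimes> y = \<one> \<otimes> e" if "y \<in> carrier R" for y
      using that one by (intro bexI[of _ \<one>] bexI[of _ y]) auto
    then show ?thesis using True by (intro bexI[of _ \<one>]) auto
  next
    case a0: False
    show ?thesis
      using a r
    proof (cases rule: divides_total)
      case (1 c)
      from x(1) 1(1) obtain d where d: "d \<in> carrier R" "x = c \<otimes> d"
      proof (cases rule: divides_total)
        case (1 d)
        then show ?thesis using that \<open>c \<in> carrier R\<close> by (auto simp: m_comm)
      next
        case (2 d)
        then have "a = d \<otimes> (r \<otimes> x)" using \<open>a = c \<otimes> r\<close> r x by (simp add: m_ac)
        then show ?thesis using rx 2 a0 by simp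
      qed
      have "a \<otimes> d = r \<otimes> x" using 1 d r by (simp add: m_ac)
      then have "a \<otimes> d = \<zero>" using rx by simp
      moreover have "\<exists>c\<in>carrier R - zerodivisors R. \<exists>e\<in>carrier R. c \<otimes> y = d \<otimes> e"
        if y: "y \<in> carrier R" "a \<otimes> y = \<zero>" for y
      proof -
        have "r \<otimes> (c \<otimes> y) = a \<otimes> y" using 1 r y by (simp add: m_ac)
        then obtain k e where k: "k \<in> carrier R - zerodivisors R" "e \<in> carrier R" "k \<otimes> (c \<otimes> y) = x \<otimes> e"
          using gen[of "c \<otimes> y"] y 1 by auto
        \<comment> \<open>\<open>k y\<close> and \<open>d e\<close> agree after multiplication by c, and \<open>(0:c) \<subseteq> R d\<close> because \<open>c d = x \<noteq> 0\<close>\<close>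
        let ?w = "k \<otimes> y \<ominus> d \<otimes> e"
        have kR: "k \<in> carrier R" using k by auto
        have wR: "?w \<in> carrier R" using kR y d k by simp
        have "c \<otimes> ?w = k \<otimes> (c \<otimes> y) \<ominus> c \<otimes> d \<otimes> e"
          using kR y d k 1 by (simp add: r_distr r_minus minus_eq m_ac)
        also have "\<dots> = \<zero>" using k d x by (simp add: minus_eq r_neg)
        finally have cw: "c \<otimes> ?w = \<zero>" .
        obtain f where f: "f \<in> carrier R" "?w = d \<otimes> f"
          using wR d(1)
        proof (cases rule: divides_total)
          case (1 f)
          then show ?thesis using that d by (auto simp: m_comm)
        next
          case (2 f)
          then have "x = f \<otimes> (c \<otimes> ?w)" using d \<open>c \<in> carrier R\<close> wR by (metis m_lcomm)
          then show ?thesis using cw 2 x by simp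
        qed
        have "k \<otimes> y = ?w \<oplus> d \<otimes> e" using kR y d k by (simp add: minus_eq a_assoc l_neg)
        also have "\<dots> = d \<otimes> (f \<oplus> e)" using f(1) d k by (simp only: f(2) r_distr)
        finally show ?thesis using k(1,2) f(1) by (intro bexI[of _ k] bexI[of _ "f \<oplus> e"]) auto
      qed
      ultimately show ?thesis using d(1) by (intro bexI[of _ d]) blast+
    next
      case (2 c)
      have "a \<otimes> (c \<otimes> x) = r \<otimes> x" using 2 a x by (simp add: m_ac)
      then have "a \<otimes> (c \<otimes> x) = \<zero>" using rx by simp
      moreover have "\<exists>k\<in>carrier R - zerodivisors R. \<exists>e\<in>carrier R. k \<otimes> y = c \<otimes> x \<otimes> e"
        if y: "y \<in> carrier R" "a \<otimes> y = \<zero>" for y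
      proof -
        obtain v where v: "v \<in> carrier R" "y = c \<otimes> v"
          using y(1) 2(1)
        proof (cases rule: divides_total)
          case (1 v)
          then show ?thesis using that 2 by (auto simp: m_comm)
        next
          case (2 w)
          then have "r = w \<otimes> (a \<otimes> y)" using \<open>r = c \<otimes> a\<close> a y(1) by (simp add: m_ac)
          then show ?thesis using y(2) 2(1) r0 by simp
        qed
        have "r \<otimes> v = a \<otimes> y" using 2 v a by (simp add: m_ac)
        then obtain k e where k: "k \<in> carrier R - zerodivisors R" "e \<in> carrier R" "k \<otimes> v = x \<otimes> e"
          using gen[OF v(1)] y by auto
        have "k \<otimes> y = c \<otimes> (k \<otimes> v)" using k v 2 by (simp add: m_ac)
        also have "\<dots> = c \<otimes> x \<otimes> e" using k(2) x 2(1) by (simp add: k(3) m_assoc)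
        finally show ?thesis using k by blast
      qed
      ultimately show ?thesis using 2(1) x(1) by (intro bexI[of _ "c \<otimes> x"]) (blast, simp)
    qed
  qed
qed

lemma finitely_generated_ideal_principal:
  assumes "finitely_generated_ideal R I"
  shows "\<exists>g\<in>carrier R. I = PIdl g"
proof -
  obtain G where G: "finite G" "G \<subseteq> carrier R" "I = genideal R G"
    using assms unfolding finitely_generated_ideal_def by auto
  show ?thesis
    using G(1,2) unfolding G(3)
  proof (induction rule: finite_induct)
    case empty
    have "Idl {} \<subseteq> {\<zero>}" by (rule genideal_minimal[OF zeroideal]) simp
    moreover have "\<zero> \<in> Idl {}"
      using additive_subgroup.zero_closed[OF ideal.axioms(1)[OF genideal_ideal[of "{}"]]] by simp
    moreover have "PIdl \<zero> = {\<zero>}" by (auto simp: cgenideal_def intro: exI[of _ \<zero>])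
    ultimately show ?case by (intro bexI[of _ \<zero>]) auto
  next
    case (insert z G)
    then obtain g where g: "g \<in> carrier R" "Idl G = PIdl g" by auto
    have z: "z \<in> carrier R" and Gc: "G \<subseteq> carrier R" using insert by auto
    have J: "ideal (Idl (insert z G)) R" using insert by (intro genideal_ideal) auto
    have self: "insert z G \<subseteq> Idl (insert z G)" using insert by (intro genideal_self) auto
    have "Idl G \<subseteq> Idl (insert z G)" using self by (intro genideal_minimal[OF J]) auto
    then have gJ: "g \<in> Idl (insert z G)" using cgenideal_self[OF g(1)] g(2) by auto
    have GG: "G \<subseteq> PIdl g" using genideal_self[OF Gc] g(2) by simp
    from z g(1) show ?case
    proof (cases rule: divides_total)
      case (1 c)
      then have "z \<in> PIdl g" by (auto simp: cgenideal_def)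
      then have "Idl (insert z G) \<subseteq> PIdl g" using GG by (intro genideal_minimal cgenideal_ideal g) auto
      then show ?thesis using cgenideal_minimal[OF J gJ] g(1) by auto
    next
      case (2 c)
      then have "g \<in> PIdl z" by (auto simp: cgenideal_def)
      then have "PIdl g \<subseteq> PIdl z" by (rule cgenideal_minimal[OF cgenideal_ideal[OF z]])
      then have "Idl (insert z G) \<subseteq> PIdl z"
        using GG cgenideal_self[OF z] by (intro genideal_minimal cgenideal_ideal z) auto
      moreover have "PIdl z \<subseteq> Idl (insert z G)" using self by (intro cgenideal_minimal[OF J]) auto
      ultimately show ?thesis using z by auto
    qed
  qed
qed

text \<open>
  A finitely generated ideal is some \<open>R g\<close>, and \<open>R \<rightarrow> R \<rightarrow> R g \<rightarrow> 0\<close> is exact when the first map is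
  multiplication by a generator of \<open>(0:g)\<close>.
\<close>

lemma coherent_if_annihilators_principal:
  assumes ann: "\<And>a. a \<in> carrier R \<Longrightarrow>
    \<exists>d\<in>carrier R. a \<otimes> d = \<zero> \<and> (\<forall>y\<in>carrier R. a \<otimes> y = \<zero> \<longrightarrow> (\<exists>e\<in>carrier R. y = e \<otimes> d))"
  shows "coherent_ring R"
  unfolding coherent_ring_def
proof (intro conjI allI impI is_cring)
  fix I assume "finitely_generated_ideal R I"
  then obtain g where g: "g \<in> carrier R" "I = PIdl g" using finitely_generated_ideal_principal by blast
  obtain d where d: "d \<in> carrier R" "g \<otimes> d = \<zero>"
    "\<And>y. y \<in> carrier R \<Longrightarrow> g \<otimes> y = \<zero> \<Longrightarrow> \<exists>e\<in>carrier R. y = e \<otimes> d"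
    using ann[OF g(1)] by blast
  let ?F = "free_module R 1" and ?M = "ideal_module R I"
  let ?f = "\<lambda>v :: nat \<Rightarrow> 'a. v 0 \<otimes> g" and ?h = "\<lambda>v :: nat \<Rightarrow> 'a. \<lambda>i\<in>{..<1::nat}. v 0 \<otimes> d"
  have M: "module R ?M" using module_ideal_module[OF is_cring cgenideal_ideal[OF g(1)]] g(2) by simp
  have single: "(\<lambda>i\<in>{..<1::nat}. a) \<in> carrier ?F" if "a \<in> carrier R" for a
    using that by (auto simp: free_module_def)
  have c0: "v 0 \<in> carrier R" if "v \<in> carrier ?F" for v
    using that by (auto simp: free_module_def)
  have ext: "v = w" if "v \<in> carrier ?F" "w \<in> carrier ?F" "v 0 = w 0" for v w
  proof (rule PiE_ext)
    show "v \<in> {..<1} \<rightarrow>\<^sub>E carrier R" "w \<in> {..<1} \<rightarrow>\<^sub>E carrier R"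
      using that(1,2) by (simp_all add: free_module_def)
    show "v i = w i" if "i \<in> {..<1}" for i using that \<open>v 0 = w 0\<close> by simp
  qed
  have "?f \<in> linear_maps R ?F ?M"
    using g(1) c0 by (auto simp: linear_maps_def free_module_def ideal_module_def g(2) cgenideal_def l_distr m_assoc)
  moreover have "?h \<in> linear_maps R ?F ?F"
    unfolding linear_maps_def
  proof (intro CollectI conjI ballI Pi_I)
    fix v w assume v: "v \<in> carrier ?F"
    then show "?h v \<in> carrier ?F" using single c0 d(1) by simp
    assume w: "w \<in> carrier ?F"
    show "?h (v \<oplus>\<^bsub>?F\<^esub> w) = ?h v \<oplus>\<^bsub>?F\<^esub> ?h w"
      using c0[OF v] c0[OF w] d(1) by (simp add: free_module_def l_distr restrict_def fun_eq_iff)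
  next
    fix a v assume "a \<in> carrier R" and v: "v \<in> carrier ?F"
    then show "?h (a \<odot>\<^bsub>?F\<^esub> v) = a \<odot>\<^bsub>?F\<^esub> ?h v"
      using c0[OF v] d(1) by (simp add: free_module_def m_assoc restrict_def fun_eq_iff)
  qed
  moreover have "?f ` carrier ?F = carrier ?M"
  proof
    show "?f ` carrier ?F \<subseteq> carrier ?M"
      using c0 by (auto simp: ideal_module_def g(2) cgenideal_def)
    show "carrier ?M \<subseteq> ?f ` carrier ?F"
    proof
      fix x assume "x \<in> carrier ?M"
      then obtain a where "a \<in> carrier R" "x = a \<otimes> g" by (auto simp: ideal_module_def g(2) cgenideal_def)
      then show "x \<in> ?f ` carrier ?F" using single by (intro image_eqI[of _ _ "\<lambda>i\<in>{..<1}. a"]) auto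
    qed
  qed
  moreover have "?h ` carrier ?F = {v \<in> carrier ?F. ?f v = \<zero>\<^bsub>?M\<^esub>}"
  proof
    show "?h ` carrier ?F \<subseteq> {v \<in> carrier ?F. ?f v = \<zero>\<^bsub>?M\<^esub>}"
    proof
      fix w assume "w \<in> ?h ` carrier ?F"
      then obtain v where v: "v \<in> carrier ?F" "w = ?h v" by blast
      have "v 0 \<otimes> d \<otimes> g = v 0 \<otimes> (g \<otimes> d)" using c0[OF v(1)] d(1) g(1) by (simp add: m_ac)
      then have "v 0 \<otimes> d \<otimes> g = \<zero>" using d(2) c0[OF v(1)] by simp
      then show "w \<in> {v \<in> carrier ?F. ?f v = \<zero>\<^bsub>?M\<^esub>}"
        using v c0[OF v(1)] d(1) single[of "v 0 \<otimes> d"] by (simp add: ideal_module_def)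
    qed
    show "{v \<in> carrier ?F. ?f v = \<zero>\<^bsub>?M\<^esub>} \<subseteq> ?h ` carrier ?F"
    proof
      fix v assume "v \<in> {v \<in> carrier ?F. ?f v = \<zero>\<^bsub>?M\<^esub>}"
      then have v: "v \<in> carrier ?F" "v 0 \<otimes> g = \<zero>" by (auto simp: ideal_module_def)
      then have "g \<otimes> v 0 = \<zero>" using c0[OF v(1)] g(1) by (simp add: m_comm)
      then obtain e where e: "e \<in> carrier R" "v 0 = e \<otimes> d" using d(3) c0[OF v(1)] by blast
      have "v = ?h (\<lambda>i\<in>{..<1}. e)" using v(1) e d(1) single[of "e \<otimes> d"] by (intro ext) auto
      then show "v \<in> ?h ` carrier ?F" using single[OF e(1)] by blast
    qed
  qed
  ultimately show "finitely_presented R ?M" unfolding finitely_presented_def using M by blast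
qed

end

lemma fraction_of_regular_denominators:
  fixes R (structure)
  assumes "cring R" and S: "S \<subseteq> carrier R" "\<one> \<in> S"
    and mc: "\<And>s t. s \<in> S \<Longrightarrow> t \<in> S \<Longrightarrow> s \<otimes> t \<in> S"
    and reg: "\<And>s x. s \<in> S \<Longrightarrow> x \<in> carrier R \<Longrightarrow> s \<otimes> x = \<zero> \<Longrightarrow> x = \<zero>"
    and a: "a \<in> carrier R" "s \<in> S" and b: "b \<in> carrier R" "t \<in> S"
  shows fraction_eq_iff: "fraction R S a s = fraction R S b t \<longleftrightarrow> t \<otimes> a = s \<otimes> b"
    and fraction_mult:
      "fraction R S a s \<otimes>\<^bsub>ring_of_fractions R S\<^esub> fraction R S b t = fraction R S (a \<otimes> b) (s \<otimes> t)"
proof -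
  interpret cring R by fact
  have SR: "s \<in> carrier R" if "s \<in> S" for s using that S(1) by auto
  have cancel: "x = y" if u: "u \<in> S" and x: "x \<in> carrier R" and y: "y \<in> carrier R" and eq: "u \<otimes> x = u \<otimes> y" for u x y
  proof -
    have "u \<otimes> (x \<ominus> y) = u \<otimes> x \<ominus> u \<otimes> y" using SR[OF u] x y by (simp add: a_minus_def r_distr r_minus)
    also have "\<dots> = \<zero>" using SR[OF u] x y eq by (simp add: a_minus_def r_neg)
    finally have "x \<ominus> y = \<zero>" using reg[OF u] x y by simp
    then show ?thesis using x y by simp
  qed
  have mem: "(c, w) \<in> fraction R S a s \<longleftrightarrow> c \<in> carrier R \<and> w \<in> S \<and> w \<otimes> a = s \<otimes> c"
    if as: "a \<in> carrier R" "s \<in> S" for a s c w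
  proof
    assume "(c, w) \<in> fraction R S a s"
    then obtain u where u: "c \<in> carrier R" "w \<in> S" "u \<in> S" "u \<otimes> (w \<otimes> a) = u \<otimes> (s \<otimes> c)"
      by (auto simp: fraction_def)
    have "w \<otimes> a = s \<otimes> c"
      by (rule cancel[OF u(3) _ _ u(4)]) (use SR as u in auto)
    then show "c \<in> carrier R \<and> w \<in> S \<and> w \<otimes> a = s \<otimes> c" using u by simp
  next
    assume "c \<in> carrier R \<and> w \<in> S \<and> w \<otimes> a = s \<otimes> c"
    then show "(c, w) \<in> fraction R S a s" using S(2) by (auto simp: fraction_def)
  qed
  have transfer: "w \<otimes> b = t \<otimes> c"
    if "a \<in> carrier R" "b \<in> carrier R" "c \<in> carrier R" "s \<in> S" "t \<in> S" "w \<in> S"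
      and ab: "t \<otimes> a = s \<otimes> b" and ac: "w \<otimes> a = s \<otimes> c" for a b c s t w
  proof (rule cancel[OF that(4)])
    note car = that(1-3) SR[OF that(4)] SR[OF that(5)] SR[OF that(6)]
    have "s \<otimes> (w \<otimes> b) = w \<otimes> (s \<otimes> b)" using car by (simp add: m_ac)
    also have "\<dots> = w \<otimes> (t \<otimes> a)" by (simp only: ab)
    also have "\<dots> = t \<otimes> (w \<otimes> a)" using car by (simp add: m_ac)
    also have "\<dots> = t \<otimes> (s \<otimes> c)" by (simp only: ac)
    also have "\<dots> = s \<otimes> (t \<otimes> c)" using car by (simp add: m_ac)
    finally show "s \<otimes> (w \<otimes> b) = s \<otimes> (t \<otimes> c)" .
    show "w \<otimes> b \<in> carrier R" "t \<otimes> c \<in> carrier R" using car by auto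
  qed
  have eq: "fraction R S a s = fraction R S b t \<longleftrightarrow> t \<otimes> a = s \<otimes> b"
    if a: "a \<in> carrier R" "s \<in> S" and b: "b \<in> carrier R" "t \<in> S" for a s b t
  proof
    assume "fraction R S a s = fraction R S b t"
    moreover have "(b, t) \<in> fraction R S b t" using mem[OF b] b by simp
    ultimately show "t \<otimes> a = s \<otimes> b" using mem[OF a] by simp
  next
    assume e: "t \<otimes> a = s \<otimes> b"
    have "(c, w) \<in> fraction R S a s \<longleftrightarrow> (c, w) \<in> fraction R S b t" for c w
      unfolding mem[OF a] mem[OF b]
      using transfer[OF a(1) b(1) _ a(2) b(2) _ e] transfer[OF b(1) a(1) _ b(2) a(2) _ e[symmetric]] by blast
    then show "fraction R S a s = fraction R S b t" by auto
  qed
  show "fraction R S a s = fraction R S b t \<longleftrightarrow> t \<otimes> a = s \<otimes> b" by (rule eq[OF a b])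
  have "fraction R S (a' \<otimes> b') (s' \<otimes> t') = fraction R S (a \<otimes> b) (s \<otimes> t)"
    if "(a', s') \<in> fraction R S a s" "(b', t') \<in> fraction R S b t" for a' b' s' t'
  proof -
    have a': "a' \<in> carrier R" "s' \<in> S" "s' \<otimes> a = s \<otimes> a'" using that(1) mem[OF a] by auto
    have b': "b' \<in> carrier R" "t' \<in> S" "t' \<otimes> b = t \<otimes> b'" using that(2) mem[OF b] by auto
    note car = a(1) b(1) a'(1) b'(1) SR[OF a(2)] SR[OF b(2)] SR[OF a'(2)] SR[OF b'(2)]
    have "s \<otimes> t \<otimes> (a' \<otimes> b') = (s \<otimes> a') \<otimes> (t \<otimes> b')" using car by (simp add: m_ac)
    also have "\<dots> = (s' \<otimes> a) \<otimes> (t' \<otimes> b)" by (simp only: a'(3) b'(3))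
    also have "\<dots> = s' \<otimes> t' \<otimes> (a \<otimes> b)" using car by (simp add: m_ac)
    finally show ?thesis using car mc[OF a(2) b(2)] mc[OF a'(2) b'(2)] by (subst eq) auto
  qed
  moreover have "(a, s) \<in> fraction R S a s" "(b, t) \<in> fraction R S b t"
    using mem[OF a] mem[OF b] a b by auto
  ultimately have "{fraction R S (a' \<otimes> b') (s' \<otimes> t') | a' s' b' t'.
      (a', s') \<in> fraction R S a s \<and> (b', t') \<in> fraction R S b t} = {fraction R S (a \<otimes> b) (s \<otimes> t)}"
    by blast
  then show "fraction R S a s \<otimes>\<^bsub>ring_of_fractions R S\<^esub> fraction R S b t = fraction R S (a \<otimes> b) (s \<otimes> t)"
    by (simp add: ring_of_fractions_def)
qed

lemma coherent_localization:
  fixes R (structure)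
  assumes "chain_ring R" and one: "\<one> \<noteq> \<zero>"
    and ann: "\<And>a. a \<in> carrier R \<Longrightarrow> \<exists>d\<in>carrier R. a \<otimes> d = \<zero> \<and> (\<forall>y\<in>carrier R. a \<otimes> y = \<zero> \<longrightarrow>
      (\<exists>c\<in>carrier R - zerodivisors R. \<exists>e\<in>carrier R. c \<otimes> y = d \<otimes> e))"
  shows "coherent_ring (localization_at R (zerodivisors R))"
proof -
  interpret chain_ring R by fact
  let ?S = "carrier R - zerodivisors R"
  let ?Q = "ring_of_fractions R ?S"
  have S: "?S \<subseteq> carrier R" "\<one> \<in> ?S" using regular_one[OF one] by auto
  note mc = regular_mult and reg = regular_cancel
  have cringQ: "cring ?Q" by (rule cring_ring_of_fractions[OF is_cring S mc])
  have eq: "fraction R ?S a s = fraction R ?S b t \<longleftrightarrow> t \<otimes> a = s \<otimes> b"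
    if "a \<in> carrier R" "s \<in> ?S" "b \<in> carrier R" "t \<in> ?S" for a s b t
    using that by - (rule fraction_eq_iff[OF is_cring S mc reg]; assumption)
  have mult: "fraction R ?S a s \<otimes>\<^bsub>?Q\<^esub> fraction R ?S b t = fraction R ?S (a \<otimes> b) (s \<otimes> t)"
    if "a \<in> carrier R" "s \<in> ?S" "b \<in> carrier R" "t \<in> ?S" for a s b t
    using that by - (rule fraction_mult[OF is_cring S mc reg]; assumption)
  have carQ: "carrier ?Q = {fraction R ?S a s | a s. a \<in> carrier R \<and> s \<in> ?S}"
    and zeroQ: "\<zero>\<^bsub>?Q\<^esub> = fraction R ?S \<zero> \<one>" by (simp_all add: ring_of_fractions_def)
  have mem: "fraction R ?S a s \<in> carrier ?Q" if "a \<in> carrier R" "s \<in> ?S" for a s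
    using that unfolding carQ by blast
  have div: "\<exists>c\<in>carrier ?Q. fraction R ?S a s = c \<otimes>\<^bsub>?Q\<^esub> fraction R ?S b t"
    if "a = c \<otimes> b" and car: "c \<in> carrier R" "b \<in> carrier R" "s \<in> ?S" "t \<in> ?S" for a b c s t
  proof -
    have tR: "t \<in> carrier R" "s \<in> carrier R" using car by auto
    have "fraction R ?S (t \<otimes> c) s \<otimes>\<^bsub>?Q\<^esub> fraction R ?S b t = fraction R ?S (t \<otimes> c \<otimes> b) (s \<otimes> t)"
      using car tR by (intro mult) auto
    also have "\<dots> = fraction R ?S a s"
      using car tR that(1) mc[OF car(3,4)] by (subst eq) (auto simp: m_ac)
    finally show ?thesis using mem[of "t \<otimes> c" s] car tR by (intro bexI[of _ "fraction R ?S (t \<otimes> c) s"]) auto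
  qed
  interpret Q: chain_ring ?Q
  proof (rule chain_ringI[OF cringQ])
    fix x y assume "x \<in> carrier ?Q" "y \<in> carrier ?Q"
    then obtain a s b t where xy: "x = fraction R ?S a s" "y = fraction R ?S b t"
      "a \<in> carrier R" "b \<in> carrier R" "s \<in> ?S" "t \<in> ?S" unfolding carQ by blast
    from xy(3,4) show "(\<exists>c\<in>carrier ?Q. x = c \<otimes>\<^bsub>?Q\<^esub> y) \<or> (\<exists>c\<in>carrier ?Q. y = c \<otimes>\<^bsub>?Q\<^esub> x)"
    proof (cases rule: divides_total)
      case (1 c)
      then show ?thesis using div[OF 1(2,1) xy(4,5,6)] unfolding xy(1,2) by blast
    next
      case (2 c)
      then show ?thesis using div[OF 2(2,1) xy(3,6,5)] unfolding xy(1,2) by blast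
    qed
  qed
  have "coherent_ring ?Q"
  proof (rule Q.coherent_if_annihilators_principal)
    fix x assume "x \<in> carrier ?Q"
    then obtain a s where x: "x = fraction R ?S a s" "a \<in> carrier R" "s \<in> ?S" unfolding carQ by blast
    have sR: "s \<in> carrier R" using x by simp
    obtain d where d: "d \<in> carrier R" "a \<otimes> d = \<zero>" "\<And>y. y \<in> carrier R \<Longrightarrow> a \<otimes> y = \<zero> \<Longrightarrow>
      \<exists>c\<in>?S. \<exists>e\<in>carrier R. c \<otimes> y = d \<otimes> e" using ann[OF x(2)] by blast
    have "x \<otimes>\<^bsub>?Q\<^esub> fraction R ?S d \<one> = fraction R ?S (a \<otimes> d) (s \<otimes> \<one>)"
      unfolding x(1) by (rule mult[OF x(2,3) d(1) S(2)])
    also have "\<dots> = \<zero>\<^bsub>?Q\<^esub>" unfolding zeroQ d(2) using x sR S(2) by (subst eq) auto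
    finally have xd: "x \<otimes>\<^bsub>?Q\<^esub> fraction R ?S d \<one> = \<zero>\<^bsub>?Q\<^esub>" .
    have "\<exists>e\<in>carrier ?Q. y = e \<otimes>\<^bsub>?Q\<^esub> fraction R ?S d \<one>"
      if y: "y \<in> carrier ?Q" "x \<otimes>\<^bsub>?Q\<^esub> y = \<zero>\<^bsub>?Q\<^esub>" for y
    proof -
      obtain b t where b: "y = fraction R ?S b t" "b \<in> carrier R" "t \<in> ?S" using y unfolding carQ by blast
      have tR: "t \<in> carrier R" using b by simp
      have "fraction R ?S (a \<otimes> b) (s \<otimes> t) = fraction R ?S \<zero> \<one>"
        using y(2) unfolding x(1) b(1) mult[OF x(2,3) b(2,3)] zeroQ .
      then have "\<one> \<otimes> (a \<otimes> b) = s \<otimes> t \<otimes> \<zero>"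
        using eq[of "a \<otimes> b" "s \<otimes> t" \<zero> \<one>] x(2) b(2) mc[OF x(3) b(3)] S(2) by simp
      then have "a \<otimes> b = \<zero>" using x b sR tR by simp
      then obtain c e where c: "c \<in> ?S" "e \<in> carrier R" "c \<otimes> b = d \<otimes> e" using d(3) b(2) by blast
      have cR: "c \<in> carrier R" using c by simp
      have "fraction R ?S e (c \<otimes> t) \<otimes>\<^bsub>?Q\<^esub> fraction R ?S d \<one> = fraction R ?S (e \<otimes> d) (c \<otimes> t \<otimes> \<one>)"
        by (rule mult[OF c(2) mc[OF c(1) b(3)] d(1) S(2)])
      also have "\<dots> = y"
      proof -
        have "t \<otimes> (e \<otimes> d) = t \<otimes> (c \<otimes> b)" using c d(1) by (simp add: m_comm)
        then have "t \<otimes> (e \<otimes> d) = c \<otimes> t \<otimes> \<one> \<otimes> b" using cR tR b(2) by (simp add: m_ac)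
        then show ?thesis unfolding b(1)
          using eq[of "e \<otimes> d" "c \<otimes> t \<otimes> \<one>" b t] c(2) d(1) mc[OF mc[OF c(1) b(3)] S(2)] b(2,3) by simp
      qed
      finally show ?thesis using mem[OF c(2) mc[OF c(1) b(3)]] by metis
    qed
    then show "\<exists>d\<in>carrier ?Q. x \<otimes>\<^bsub>?Q\<^esub> d = \<zero>\<^bsub>?Q\<^esub> \<and>
        (\<forall>y\<in>carrier ?Q. x \<otimes>\<^bsub>?Q\<^esub> y = \<zero>\<^bsub>?Q\<^esub> \<longrightarrow> (\<exists>e\<in>carrier ?Q. y = e \<otimes>\<^bsub>?Q\<^esub> d))"
      using xd mem[OF d(1) S(2)] by blast
  qed
  then show ?thesis by (simp add: localization_at_def)
qed


section \<open>Chain rings whose ideals are flat modulo their annihilators\<close>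

theorem theorem2p6:
  fixes R :: "('a, 'm) ring_scheme"
    and Z N :: "'a set"
    and Q :: "('a \<times> 'a) set ring"
  assumes "chain_ring R"
    and "Z = zerodivisors R"
    and "N = nilradical R"
    and "Q = localization_at R Z"
    and "Z \<noteq> ideal_prod R Z Z \<or> \<not> coherent_ring Q"
  shows "Z = N \<longleftrightarrow>
    (\<forall>I. ideal I R \<longrightarrow>
      flat_module (R Quot (annihilator R I)) (over_quotient (ideal_module R I)))"
proof -
  interpret chain_ring R by fact
  have "Z = N \<longleftrightarrow> (\<forall>I. ideal I R \<longrightarrow> flat_criterion I)"
  proof
    assume ZN: "Z = N"
    show "\<forall>I. ideal I R \<longrightarrow> flat_criterion I"
    proof (intro allI impI)
      fix I assume I: "ideal I R"
      from assms(5) show "flat_criterion I"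
      proof
        assume "Z \<noteq> ideal_prod R Z Z"
        then show ?thesis using ZN I assms(2,3) by (intro flat_criterion_if_zerodivisors_not_idempotent) auto
      next
        assume nc: "\<not> coherent_ring Q"
        show ?thesis
        proof (rule flat_criterion_if_nilpotently_divisible[OF I], rule ccontr)
          fix r x assume r: "r \<in> carrier R" "r \<noteq> \<zero>\<^bsub>R\<^esub>" and x: "x \<in> carrier R" "x \<noteq> \<zero>\<^bsub>R\<^esub>"
            and rx: "r \<otimes>\<^bsub>R\<^esub> x = \<zero>\<^bsub>R\<^esub>"
            and none: "\<not> (\<exists>q\<in>nilradical R. \<exists>x'\<in>carrier R. r \<otimes>\<^bsub>R\<^esub> x' = \<zero>\<^bsub>R\<^esub> \<and> x = q \<otimes>\<^bsub>R\<^esub> x')"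
          have one: "\<one>\<^bsub>R\<^esub> \<noteq> \<zero>\<^bsub>R\<^esub>" using x by (metis l_null l_one)
          have gen: "\<exists>c\<in>carrier R - zerodivisors R. \<exists>e\<in>carrier R. c \<otimes>\<^bsub>R\<^esub> y = x \<otimes>\<^bsub>R\<^esub> e"
            if y: "y \<in> carrier R" "r \<otimes>\<^bsub>R\<^esub> y = \<zero>\<^bsub>R\<^esub>" for y
            using y(1) x(1)
          proof (cases rule: divides_total)
            case (1 c)
            then have "\<one>\<^bsub>R\<^esub> \<otimes>\<^bsub>R\<^esub> y = x \<otimes>\<^bsub>R\<^esub> c" using x by (simp add: m_comm)
            then show ?thesis using 1(1) regular_one[OF one] by blast
          next
            case (2 c)
            then have "c \<notin> zerodivisors R" using none y ZN assms(2,3) by blast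
            moreover have "c \<otimes>\<^bsub>R\<^esub> y = x \<otimes>\<^bsub>R\<^esub> \<one>\<^bsub>R\<^esub>" using 2 x by simp
            ultimately show ?thesis using 2(1) by blast
          qed
          have "coherent_ring Q"
            unfolding assms(2,4)
            by (rule coherent_localization[OF assms(1) one])
               (rule annihilators_principal_up_to_regular[OF r(1) x rx r(2) gen])
          then show False using nc by simp
        qed
      qed
    qed
  next
    assume "\<forall>I. ideal I R \<longrightarrow> flat_criterion I"
    then show "Z = N"
      using zerodivisors_subset_nilradical ideal_nilradical nilradical_subset_zerodivisors assms(2,3) by blast
  qed
  then show ?thesis using flat_over_quotient_iff by simp
qed

end
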